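(* The following statements are equivalent: (i) For every $t\in\mathbb{T}$ and every $x\in l^2_{\mathcal{F}}(t;\mathbb{R})$, Problem (MV)$_{tx}$ admits a feedback equilibrium strategy. (ii) The difference equations $$\left\{\begin{array}{l} \widetilde{S}_k=\widetilde{S}_{k+1}\Big[s_k^2-2s_k(\mathbb{E}O_k)^T\widetilde{\mathbb{O}}_k^\dagger\widetilde{\mathbb{L}}_k+\widetilde{\mathbb{L}}_k^T\widetilde{\mathbb{O}}_k^\dagger\,\mathbb{E}(O_kO_k^T)\,\widetilde{\mathbb{O}}_k^\dagger\widetilde{\mathbb{L}}_k\Big],\\ \widetilde{\mathcal{S}}_k=s_k^2\widetilde{\mathcal{S}}_{k+1}-2s_k\widetilde{\mathcal{S}}_{k+1}(\mathbb{E}O_k)^T\widetilde{\mathbb{O}}_k^\dagger\widetilde{\mathbb{L}}_k+\widetilde{\mathbb{L}}_k^T\widetilde{\mathbb{O}}_k^\dagger\widetilde{\mathbb{L}}_k,\\ \widetilde{S}_N=1,\quad\widetilde{\mathcal{S}}_N=0,\\ \widetilde{\mathbb{O}}_k\succeq0,\quad\widetilde{\mathbb{O}}_k\widetilde{\mathbb{O}}_k^\dagger\widetilde{\mathbb{L}}_k=\widetilde{\mathbb{L}}_k,\quad k\in\mathbb{T}, \end{array}\right.$$ and $$\left\{\begin{array}{l} \widetilde{\pi}_k=-\widetilde{\beta}_k\widetilde{\mathbb{O}}_k^\dagger\widetilde{\theta}_k+\big(s_k-(\mathbb{E}O_k)^T\widetilde{\mathbb{O}}_k^\dagger\widetilde{\mathbb{L}}_k\big)\widetilde{\pi}_{k+1},\\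 \widetilde{\pi}_N=-\frac{\mu_2}{2},\\ \widetilde{\mathbb{O}}_k\widetilde{\mathbb{O}}_k^\dagger\widetilde{\theta}_k=\widetilde{\theta}_k,\quad k\in\mathbb{T}, \end{array}\right.$$ are solvable, i.e. the quantities generated by these backward recursions satisfy $\widetilde{\mathbb{O}}_k\succeq0$, $\widetilde{\mathbb{O}}_k\widetilde{\mathbb{O}}_k^\dagger\widetilde{\mathbb{L}}_k=\widetilde{\mathbb{L}}_k$ and $\widetilde{\mathbb{O}}_k\widetilde{\mathbb{O}}_k^\dagger\widetilde{\theta}_k=\widetilde{\theta}_k$ for all $k\in\mathbb{T}$. Here, for $k\in\mathbb{T}$, $$\widetilde{\mathbb{O}}_k=\widetilde{\mathcal{S}}_{k+1}\mathbb{E}O_k(\mathbb{E}O_k)^T+\widetilde{S}_{k+1}\mathrm{Cov}(O_k),\quad\widetilde{\mathbb{L}}_k=\big(s_k\widetilde{\mathcal{S}}_{k+1}+\widetilde{U}_{k+1}\big)\mathbb{E}O_k,\quad\widetilde{\theta}_k=\widetilde{\pi}_{k+1}\mathbb{E}O_k,$$ $$\widetilde{U}_k=\big(s_k-(\mathbb{E}O_k)^T\widetilde{\mathbb{O}}_k^\dagger\widetilde{\mathbb{L}}_k\big)\widetilde{U}_{k+1},\quad\widetilde{U}_N=-\tfrac{\mu_1}{2},$$ $$\widetilde{\beta}_k=s_k\widetilde{\mathcal{S}}_{k+1}(\mathbb{E}O_k)^T-\widetilde{\mathbb{L}}_k^T\widetilde{\mathbb{O}}_k^\dagger\big[\wi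detilde{\mathcal{S}}_{k+1}\mathbb{E}O_k(\mathbb{E}O_k)^T+\widetilde{S}_{k+1}\mathrm{Cov}(O_k)\big].$$
   Context: Model. $N\ge 1$ and $m\ge 1$ are integers, $\mathbb{T}=\{0,\dots,N-1\}$, $\mathbb{T}_t=\{t,\dots,N-1\}$. For $k\in\mathbb{T}$, $s_k>1$ is a given deterministic number (return of the riskless asset) and $e_k=(e_k^1,\dots,e_k^m)^T$ is an $\mathbb{R}^m$-valued random vector with finite second moments (returns of $m$ risky assets); $e_0,\dots,e_{N-1}$ are independent. $O_k=(e_k^1-s_k,\dots,e_k^m-s_k)^T$ is the excess return vector, and $\mathrm{Cov}(O_k)=\mathrm{Cov}(e_k)=\mathbb{E}[(e_k-\mathbb{E}e_k)(e_k-\mathbb{E}e_k)^T]\succeq0$ (not assumed nonsingular). $\mathcal{F}_k=\sigma(e_\ell,\ \ell=0,\dots,k-1)$ ($\mathcal{F}_0$ trivial) and $\mathbb{E}_t=\mathbb{E}[\,\cdot\,|\mathcal{F}_t]$. $l^2_{\mathcal{F}}(k;\mathbb{R}^d)$ is the set of $\mathcal{F}_k$-measurable square-integrable $\mathbb{R}^d$-valued random variables, and $l^2_{\mathcal{F}}(\mathbb{T}_t;\mathbb{R}^m)$ is the set of processes $\{\nu_k,k\in\mathbb{T}_t\}$ with $\nu_k\in l^2_{\mathcal{F}}(k;\mathbb{R}^m)$ for each $k\in\mathbb{T}_t$. Problem (MV)$_{tx}$ (multi-period mean-variance problem for the initial pair $(t,x)$, $t\in\mathbb{T}$, $x\in l^2_{\mathcal{F}}(t;\mathbb{R})$):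 with controls $u\in l^2_{\mathcal{F}}(\mathbb{T}_t;\mathbb{R}^m)$ (short-selling allowed), wealth dynamics $X_{k+1}=s_kX_k+O_k^Tu_k$, $k\in\mathbb{T}_t$, $X_t=x$, and cost $$J(t,x;u)=\mathbb{E}_t(X_N-\mathbb{E}_tX_N)^2-(\mu_1x+\mu_2)\mathbb{E}_tX_N,$$ where $\mu_1,\mu_2>0$ are constants. Feedback strategies. A (admissible) feedback strategy at stage $k$ is a function $f_k(\cdot)$ such that $f_k(\zeta)\in l^2_{\mathcal{F}}(k;\mathbb{R}^m)$ for every $\zeta\in l^2_{\mathcal{F}}(k;\mathbb{R})$; $\mathbb{F}_k$ is the set of these and $\mathbb{F}_{\mathbb{T}_t}=\mathbb{F}_t\times\cdots\times\mathbb{F}_{N-1}$. Feedback equilibrium strategy. $\psi=(\psi_t,\dots,\psi_{N-1})\in\mathbb{F}_{\mathbb{T}_t}$ is a feedback equilibrium strategy of Problem (MV)$_{tx}$ if (a) $\psi$ does not depend on $x$; (b) for every $k\in\mathbb{T}_t$ and $u_k\in l^2_{\mathcal{F}}(k;\mathbb{R}^m)$, $$J\big(k,X_k^{t,x,*};(\psi_k(X_k^{k,\psi}),\dots,\psi_{N-1}(X_{N-1}^{k,\psi}))\big)\le J\big(k,X_k^{t,x,*};(u_k,\psi_{k+1}(X_{k+1}^{k,u_k,\psi}),\dots,\psi_{N-1}(X_{N-1}^{k,u_k,\psi}))\big)\quad\text{a.s.},$$ where $X^{t,x,*}_{\ell+1}=s_\ell X^{t,x,*}_\ell+O_\ell^T\psi_\ell(X^{t,x,*}_\ell)$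 for $\ell\in\mathbb{T}_t$, $X^{t,x,*}_t=x$; $X^{k,\psi}_{\ell+1}=s_\ell X^{k,\psi}_\ell+O_\ell^T\psi_\ell(X^{k,\psi}_\ell)$ for $\ell\in\mathbb{T}_k$, $X^{k,\psi}_k=X^{t,x,*}_k$; and $X^{k,u_k,\psi}_{\ell+1}=s_\ell X^{k,u_k,\psi}_\ell+O_\ell^T\psi_\ell(X^{k,u_k,\psi}_\ell)$ for $\ell\in\mathbb{T}_{k+1}=\{k+1,\dots,N-1\}$, $X^{k,u_k,\psi}_{k+1}=s_kX^{k,u_k,\psi}_k+O_k^Tu_k$, $X^{k,u_k,\psi}_k=X^{t,x,*}_k$. Notation: $A^\dagger$ is the Moore–Penrose inverse; $\succeq0$ means symmetric positive semidefinite. $\widetilde S_k,\widetilde{\mathcal S}_k,\widetilde U_k,\widetilde\pi_k$ are scalars, $\widetilde{\mathbb{O}}_k\in\mathbb{R}^{m\times m}$, $\widetilde{\mathbb{L}}_k,\widetilde\theta_k\in\mathbb{R}^m$ are column vectors, $\widetilde\beta_k$ is a row vector.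
   Formalization: "ψ does not depend on x" is read as: the same ψ satisfies (b) from every initial state y in l²_F(k;R) at every stage k ≥ t, not only along paths from (t,x); if only x at stage t varies, (i) does not imply (ii) (N=3, O_0=1, O_1, O_2 independent ±1). *)

theory Defs
  imports "HOL-Probability.Probability"
begin

section \<open>Matrices\<close>

definition is_pinv :: "real^'n^'m \<Rightarrow> real^'m^'n \<Rightarrow> bool" where
  "is_pinv A B \<longleftrightarrow> A ** B ** A = A \<and> B ** A ** B = B \<and>
     transpose (A ** B) = A ** B \<and> transpose (B ** A) = B ** A"

text \<open>The Moore--Penrose inverse, characterised by the four Penrose equations.\<close>
definition pinv :: "real^'n^'m \<Rightarrow> real^'m^'n" where
  "pinv A = (THE B. is_pinv A B)"

lemma is_pinv_unique:
  assumes "is_pinv A B" "is_pinv A C"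
  shows "B = C"
proof -
  have B: "A ** B ** A = A" "B ** A ** B = B" "transpose (A ** B) = A ** B" "transpose (B ** A) = B ** A"
    and C: "A ** C ** A = A" "C ** A ** C = C" "transpose (A ** C) = A ** C" "transpose (C ** A) = C ** A"
    using assms by (auto simp: is_pinv_def)
  have "A ** B = (A ** C) ** (A ** B)"
    by (metis C(1) matrix_mul_assoc)
  also have "\<dots> = transpose ((A ** B) ** (A ** C))"
    by (simp only: matrix_transpose_mul[of "A ** B" "A ** C"] B(3) C(3))
  also have "\<dots> = A ** C"
    by (metis B(1) C(3) matrix_mul_assoc)
  finally have 1: "A ** B = A ** C" .
  have "B ** A = (B ** A) ** (C ** A)"
    by (metis C(1) matrix_mul_assoc)
  also have "\<dots> = transpose ((C ** A) ** (B ** A))"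
    by (simp only: matrix_transpose_mul[of "C ** A" "B ** A"] B(4) C(4))
  also have "\<dots> = C ** A"
    by (metis B(1) C(4) matrix_mul_assoc)
  finally have 2: "B ** A = C ** A" .
  show "B = C"
    by (metis 1 2 B(2) C(2) matrix_mul_assoc)
qed

lemma pinv_eqI: "is_pinv A B \<Longrightarrow> pinv A = B"
  unfolding pinv_def by (blast intro: is_pinv_unique)

definition psd :: "real^'n^'n \<Rightarrow> bool" where
  "psd A \<longleftrightarrow> transpose A = A \<and> (\<forall>v. 0 \<le> v \<bullet> (A *v v))"

text \<open>\<open>outer a b\<close> is \<open>a b\<^sup>T\<close>.\<close>
definition outer :: "real^'n \<Rightarrow> real^'n \<Rightarrow> real^'n^'n" where
  "outer a b = (\<chi> i j. a $ i * b $ j)"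

definition second_moment :: "'a measure \<Rightarrow> ('a \<Rightarrow> real^'n) \<Rightarrow> real^'n^'n" where
  "second_moment M Z = (\<chi> i j. \<integral>\<omega>. Z \<omega> $ i * Z \<omega> $ j \<partial>M)"

definition cov_mat :: "'a measure \<Rightarrow> ('a \<Rightarrow> real^'n) \<Rightarrow> real^'n^'n" where
  "cov_mat M Z = second_moment M (\<lambda>\<omega>. Z \<omega> - (\<integral>\<xi>. Z \<xi> \<partial>M))"


section \<open>The market\<close>

definition excess :: "(nat \<Rightarrow> real) \<Rightarrow> (nat \<Rightarrow> 'a \<Rightarrow> real^'m) \<Rightarrow> nat \<Rightarrow> 'a \<Rightarrow> real^'m" where
  "excess s e k \<omega> = (\<chi> i. e k \<omega> $ i - s k)"

definition filt :: "'a measure \<Rightarrow> (nat \<Rightarrow> 'a \<Rightarrow> real^'m) \<Rightarrow> nat \<Rightarrow> 'a measure" where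
  "filt M e k = sigma (space M) (\<Union>l<k. {e l -` B \<inter> space M | B. B \<in> sets borel})"

text \<open>\<open>l2 M F\<close> is the set of \<open>F\<close>-measurable random variables that are square-integrable
  with respect to \<open>M\<close>.\<close>
definition l2 :: "'a measure \<Rightarrow> 'a measure \<Rightarrow> ('a \<Rightarrow> 'b::euclidean_space) set" where
  "l2 M F = {f \<in> borel_measurable F. integrable M (\<lambda>\<omega>. (norm (f \<omega>))\<^sup>2)}"

text \<open>A control process is indexed by stages. The wealth at stages before the initial stage \<open>t\<close>
  is irrelevant and set to the initial wealth \<open>x\<close>.\<close>
primrec wealth :: "(nat \<Rightarrow> real) \<Rightarrow> (nat \<Rightarrow> 'a \<Rightarrow> real^'m) \<Rightarrow> nat \<Rightarrow> ('a \<Rightarrow> real) \<Rightarrow>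
    (nat \<Rightarrow> 'a \<Rightarrow> real^'m) \<Rightarrow> nat \<Rightarrow> 'a \<Rightarrow> real" where
  "wealth s e t x u 0 = x"
| "wealth s e t x u (Suc k) =
     (if k < t then x else (\<lambda>\<omega>. s k * wealth s e t x u k \<omega> + excess s e k \<omega> \<bullet> u k \<omega>))"

definition cost :: "'a measure \<Rightarrow> (nat \<Rightarrow> real) \<Rightarrow> (nat \<Rightarrow> 'a \<Rightarrow> real^'m) \<Rightarrow> real \<Rightarrow> real \<Rightarrow> nat \<Rightarrow>
    nat \<Rightarrow> ('a \<Rightarrow> real) \<Rightarrow> (nat \<Rightarrow> 'a \<Rightarrow> real^'m) \<Rightarrow> 'a \<Rightarrow> real" where
  "cost M s e \<mu>1 \<mu>2 N t x u \<omega> =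
     (let E = real_cond_exp M (filt M e t); X = wealth s e t x u N
      in E (\<lambda>\<xi>. (X \<xi> - E X \<xi>)\<^sup>2) \<omega> - (\<mu>1 * x \<omega> + \<mu>2) * E X \<omega>)"


section \<open>Feedback strategies\<close>

text \<open>A feedback strategy at a stage maps the current wealth, as a random variable, to a control.\<close>
type_synonym ('a, 'm) strategy = "('a \<Rightarrow> real) \<Rightarrow> 'a \<Rightarrow> real^'m"

definition admissible :: "'a measure \<Rightarrow> (nat \<Rightarrow> 'a \<Rightarrow> real^'m) \<Rightarrow> nat \<Rightarrow> nat \<Rightarrow>
    (nat \<Rightarrow> ('a, 'm::finite) strategy) \<Rightarrow> bool" where
  "admissible M e N t \<psi> \<longleftrightarrow>
     (\<forall>k\<in>{t..<N}. \<forall>\<zeta>\<in>l2 M (filt M e k). \<psi> k \<zeta> \<in> l2 M (filt M e k))"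

text \<open>The wealth under a feedback strategy, started from \<open>x\<close> at stage \<open>t\<close>.\<close>
primrec fb_wealth :: "(nat \<Rightarrow> real) \<Rightarrow> (nat \<Rightarrow> 'a \<Rightarrow> real^'m) \<Rightarrow>
    (nat \<Rightarrow> ('a, 'm::finite) strategy) \<Rightarrow> nat \<Rightarrow> ('a \<Rightarrow> real) \<Rightarrow> nat \<Rightarrow> 'a \<Rightarrow> real" where
  "fb_wealth s e \<psi> t x 0 = x"
| "fb_wealth s e \<psi> t x (Suc k) =
     (if k < t then x
      else (\<lambda>\<omega>. s k * fb_wealth s e \<psi> t x k \<omega> + excess s e k \<omega> \<bullet> \<psi> k (fb_wealth s e \<psi> t x k) \<omega>))"

definition fb_control :: "(nat \<Rightarrow> real) \<Rightarrow> (nat \<Rightarrow> 'a \<Rightarrow> real^'m) \<Rightarrow>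
    (nat \<Rightarrow> ('a, 'm::finite) strategy) \<Rightarrow> nat \<Rightarrow> ('a \<Rightarrow> real) \<Rightarrow> nat \<Rightarrow> 'a \<Rightarrow> real^'m" where
  "fb_control s e \<psi> t x k = \<psi> k (fb_wealth s e \<psi> t x k)"

text \<open>The equilibrium inequalities along the path started from the initial pair \<open>(t, x)\<close>.
  Replacing stage \<open>k\<close> of \<open>\<psi>\<close> by the constant map to \<open>u\<close> yields the control
  \<open>(u, \<psi>\<^sub>k\<^sub>+\<^sub>1(X\<^sub>k\<^sub>+\<^sub>1), \<dots>)\<close>, where \<open>X\<close> is the wealth perturbed by playing \<open>u\<close> at stage \<open>k\<close>.\<close>
definition equilibrium_along :: "'a measure \<Rightarrow> (nat \<Rightarrow> real) \<Rightarrow> (nat \<Rightarrow> 'a \<Rightarrow> real^'m) \<Rightarrow>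
    real \<Rightarrow> real \<Rightarrow> nat \<Rightarrow> nat \<Rightarrow> ('a \<Rightarrow> real) \<Rightarrow> (nat \<Rightarrow> ('a, 'm::finite) strategy) \<Rightarrow> bool" where
  "equilibrium_along M s e \<mu>1 \<mu>2 N t x \<psi> \<longleftrightarrow>
     (\<forall>k\<in>{t..<N}. \<forall>u\<in>l2 M (filt M e k).
        let X = fb_wealth s e \<psi> t x k
        in AE \<omega> in M.
             cost M s e \<mu>1 \<mu>2 N k X (fb_control s e \<psi> k X) \<omega>
             \<le> cost M s e \<mu>1 \<mu>2 N k X (fb_control s e (\<psi>(k := \<lambda>_. u)) k X) \<omega>)"

text \<open>That \<open>\<psi>\<close> does not depend on the initial state is read as in the usual notion of a feedback
  (closed-loop) equilibrium: the same maps \<open>\<psi>\<^sub>k, \<dots>, \<psi>\<^sub>N\<^sub>-\<^sub>1\<close> satisfy the equilibrium inequalities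
  from every initial state \<open>y\<close> of every stage \<open>k \<ge> t\<close>, not just from the states on the path
  started at \<open>(t, x)\<close>. If only the initial state of stage \<open>t\<close> were varied, \<open>\<psi>\<close> would be
  unconstrained at states off the equilibrium paths, and the values there could be chosen so as
  to deter any deviation; equilibria would then exist even when the difference equations
  are not solvable.\<close>
definition state_independent :: "'a measure \<Rightarrow> (nat \<Rightarrow> real) \<Rightarrow> (nat \<Rightarrow> 'a \<Rightarrow> real^'m) \<Rightarrow>
    real \<Rightarrow> real \<Rightarrow> nat \<Rightarrow> nat \<Rightarrow> (nat \<Rightarrow> ('a, 'm::finite) strategy) \<Rightarrow> bool" where
  "state_independent M s e \<mu>1 \<mu>2 N t \<psi> \<longleftrightarrow>
     (\<forall>k\<in>{t..<N}. \<forall>y\<in>l2 M (filt M e k). equilibrium_along M s e \<mu>1 \<mu>2 N k y \<psi>)"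

definition feedback_equilibrium :: "'a measure \<Rightarrow> (nat \<Rightarrow> real) \<Rightarrow> (nat \<Rightarrow> 'a \<Rightarrow> real^'m) \<Rightarrow>
    real \<Rightarrow> real \<Rightarrow> nat \<Rightarrow> nat \<Rightarrow> ('a \<Rightarrow> real) \<Rightarrow> (nat \<Rightarrow> ('a, 'm::finite) strategy) \<Rightarrow> bool" where
  "feedback_equilibrium M s e \<mu>1 \<mu>2 N t x \<psi> \<longleftrightarrow>
     admissible M e N t \<psi> \<and>
     state_independent M s e \<mu>1 \<mu>2 N t \<psi> \<and>
     equilibrium_along M s e \<mu>1 \<mu>2 N t x \<psi>"


section \<open>The difference equations\<close>

text \<open>Solvability of the two coupled systems. The backward recursions determine the sequences
  \<open>S\<close>, \<open>V\<close> (the calligraphic \<open>S\<close>), \<open>U\<close> and \<open>p\<close> (for \<open>\<pi>\<close>) uniquely on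
  \<open>{0..N}\<close> from their values at \<open>N\<close>, so the existential quantifier merely names them.
  Row vectors are represented by elements of \<open>real^'m\<close>, and their products with column vectors
  by inner products.\<close>
definition difference_equations_solvable :: "'a measure \<Rightarrow> (nat \<Rightarrow> real) \<Rightarrow>
    (nat \<Rightarrow> 'a \<Rightarrow> real^'m) \<Rightarrow> real \<Rightarrow> real \<Rightarrow> nat \<Rightarrow> bool" where
  "difference_equations_solvable M s e \<mu>1 \<mu>2 N \<longleftrightarrow>
     (\<exists>S V U p :: nat \<Rightarrow> real.
        S N = 1 \<and> V N = 0 \<and> U N = - \<mu>1 / 2 \<and> p N = - \<mu>2 / 2 \<and>
        (\<forall>k<N.
          let EO = (\<integral>\<omega>. excess s e k \<omega> \<partial>M);
              EOO = second_moment M (excess s e k);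
              \<O> = V (Suc k) *\<^sub>R outer EO EO + S (Suc k) *\<^sub>R cov_mat M (excess s e k);
              \<L> = (s k * V (Suc k) + U (Suc k)) *\<^sub>R EO;
              \<theta> = p (Suc k) *\<^sub>R EO;
              \<beta> = (s k * V (Suc k)) *\<^sub>R EO
                - (\<L> v* pinv \<O>) v* (V (Suc k) *\<^sub>R outer EO EO + S (Suc k) *\<^sub>R cov_mat M (excess s e k))
          in S k = S (Suc k) *
                ((s k)\<^sup>2 - 2 * s k * (EO \<bullet> (pinv \<O> *v \<L>))
                 + \<L> \<bullet> (pinv \<O> *v (EOO *v (pinv \<O> *v \<L>)))) \<and>
             V k = (s k)\<^sup>2 * V (Suc k) - 2 * s k * V (Suc k) * (EO \<bullet> (pinv \<O> *v \<L>))
                + \<L> \<bullet> (pinv \<O> *v \<L>) \<and>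
             U k = (s k - EO \<bullet> (pinv \<O> *v \<L>)) * U (Suc k) \<and>
             p k = - (\<beta> \<bullet> (pinv \<O> *v \<theta>)) + (s k - EO \<bullet> (pinv \<O> *v \<L>)) * p (Suc k) \<and>
             psd \<O> \<and>
             \<O> *v (pinv \<O> *v \<L>) = \<L> \<and>
             \<O> *v (pinv \<O> *v \<theta>) = \<theta>))"

end

theory Submission
  imports Defs
begin

text \<open>If the strategies after stage \<open>k\<close> are affine in the wealth, the terminal wealth reached from
  wealth \<open>y\<close> at stage \<open>k\<close> has conditional mean \<open>\<alpha> y + \<gamma>\<close> and conditional second moment
  \<open>S y\<^sup>2 + 2 q y + r\<close> with deterministic coefficients. By the tower property the cost of playing \<open>u\<close> at
  stage \<open>k\<close> is then a positive semidefinite quadratic in \<open>u\<close>, with matrix \<open>\<O>\<close> and linear part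
  \<open>2 (y \<L> + \<theta>)\<close>, so a control is optimal iff \<open>\<O> u = - (y \<L> + \<theta>)\<close>. Letting \<open>y\<close> run through the
  constants, an optimal control exists iff \<open>\<L>\<close> and \<open>\<theta>\<close> lie in the range of \<open>\<O>\<close>. An optimal control
  is unique only up to the kernel of \<open>\<O>\<close>, but kernel directions do not affect the moments of the
  terminal wealth; hence the moments at stage \<open>k\<close> are again of the above form, with coefficients
  given by the difference equations, and backward induction applies to arbitrary equilibria.\<close>

section \<open>Symmetric matrices\<close>

lemma symmetric_vector_mult:
  fixes A :: "real^'n^'n"
  assumes "transpose A = A"
  shows "x v* A = A *v x"
  by (metis assms transpose_matrix_vector)

lemma symmetric_inner_mult:
  fixes A :: "real^'n^'n"
  assumes "transpose A = A"
  shows "(A *v x) \<bullet> y = x \<bullet> (A *v y)"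
  by (metis assms dot_lmul_matrix symmetric_vector_mult)

text \<open>The kernel of a symmetric matrix is orthogonal to its range, so \<open>A\<close> is
  injective on its range and, by dimension, maps the range onto itself. Each column of
  \<open>A\<close> is therefore of the form \<open>A (A x)\<close>; \<open>X\<close> collects these
  \<open>x\<close>. The pseudoinverse is built from it.\<close>

lemma symmetric_factor_square:
  fixes A :: "real^'n^'n"
  assumes "transpose A = A"
  obtains X where "A ** A ** X = A"
proof -
  let ?f = "(*v) A"
  let ?R = "range ?f"
  have lin: "linear ?f" by simp
  have sub: "subspace ?R"
    using lin by (rule linear_subspace_image) simp
  have "x = 0" if x: "x \<in> ?R" "?f x = 0" for x
  proof -
    from x obtain z where z: "x = A *v z" by blast
    have "x \<bullet> x = z \<bullet> (A *v x)"
      using z symmetric_inner_mult[OF assms, of z x] by simp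
    then show ?thesis using x by simp
  qed
  then have inj: "inj_on ?f ?R"
    using linear_inj_on_iff_eq_0[OF lin sub] by blast
  have "dim (?f ` ?R) = dim ?R"
    using inj by (intro dim_image_eq[OF lin]) (simp only: span_eq_iff[THEN iffD2, OF sub])
  then have R: "?f ` ?R = ?R"
    using sub linear_subspace_image[OF lin sub]
    by (intro subspace_dim_equal) auto
  have "\<exists>x. A *v axis j 1 = A *v (A *v x)" for j
  proof -
    have "A *v axis j 1 \<in> ?f ` ?R" unfolding R by simp
    then show ?thesis by auto
  qed
  then obtain x where x: "\<And>j. A *v axis j 1 = A *v (A *v x j)" by metis
  have "A $ i $ j = (A ** (A ** (\<chi> i j. x j $ i))) $ i $ j" for i j
  proof -
    have "A $ i $ j = (A *v axis j 1) $ i" 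
      by (simp add: matrix_vector_mult_basis column_def)
    also have "\<dots> = (A *v (A *v x j)) $ i" using x by simp
    finally show ?thesis
      by (simp add: matrix_matrix_mult_def matrix_vector_mult_def)
  qed
  then have "A ** A ** (\<chi> i j. x j $ i) = A"
    by (simp add: vec_eq_iff matrix_mul_assoc[symmetric])
  then show thesis by (rule that)
qed

text \<open>If \<open>A = A\<^sup>2 X\<close>, then \<open>A X = X\<^sup>T A\<close> is the orthogonal projection onto the range of \<open>A\<close>,
  and \<open>X\<^sup>T A X\<close> is the inverse of \<open>A\<close> on this range.\<close>
lemma
  fixes A :: "real^'n^'n"
  assumes A: "transpose A = A"
  shows is_pinv_pinv: "is_pinv A (pinv A)"
    and transpose_pinv: "transpose (pinv A) = pinv A"
proof -
  obtain X where X: "A ** A ** X = A" using symmetric_factor_square[OF A] .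
  define Y where "Y = transpose X"
  define B where "B = Y ** A ** X"
  have "transpose (A ** A ** X) = Y ** (A ** A)"
    by (simp only: matrix_transpose_mul A Y_def)
  then have Y: "Y ** (A ** A) = A"
    unfolding X A by simp
  have "A ** X = Y ** (A ** A) ** X" unfolding Y ..
  also have "\<dots> = Y ** (A ** A ** X)" by (simp only: matrix_mul_assoc)
  finally have AX: "A ** X = Y ** A" unfolding X .
  have tAX: "transpose (A ** X) = A ** X"
    unfolding AX[unfolded Y_def] matrix_transpose_mul A transpose_transpose ..
  have "A ** B = A ** (Y ** A) ** X" by (simp only: B_def matrix_mul_assoc)
  also have "\<dots> = A ** A ** X ** X" unfolding AX[symmetric] by (simp only: matrix_mul_assoc)
  finally have AB: "A ** B = A ** X" unfolding X .
  have "B ** A = Y ** (A ** X) ** A" by (simp only: B_def matrix_mul_assoc)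
  also have "\<dots> = Y ** (Y ** (A ** A))" unfolding AX by (simp only: matrix_mul_assoc)
  finally have BA: "B ** A = A ** X" unfolding Y AX .
  have "A ** B ** A = Y ** (A ** A)" unfolding AB AX by (simp only: matrix_mul_assoc)
  then have ABA: "A ** B ** A = A" unfolding Y .
  have "Y ** A ** (A ** X) = Y ** (A ** A) ** X" by (simp only: matrix_mul_assoc)
  then have PP: "(A ** X) ** (A ** X) = A ** X" unfolding Y AX[symmetric] .
  have "B ** A ** B = B ** (A ** X)" unfolding matrix_mul_assoc[symmetric] AB ..
  also have "\<dots> = Y ** ((A ** X) ** (A ** X))" by (simp only: B_def matrix_mul_assoc)
  also have "\<dots> = B" unfolding PP by (simp only: B_def matrix_mul_assoc)
  finally have "B ** A ** B = B" .
  then have "is_pinv A B"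
    using AB BA ABA tAX by (simp add: is_pinv_def)
  moreover from this have "pinv A = B" by (rule pinv_eqI)
  moreover have "transpose B = B"
    by (simp add: B_def Y_def matrix_transpose_mul A matrix_mul_assoc)
  ultimately show "is_pinv A (pinv A)" "transpose (pinv A) = pinv A" by simp_all
qed

text \<open>The Penrose identity \<open>A ** pinv A ** A = A\<close> applied to the preimage
  \<open>x\<close>. It turns solvability of a linear system into the range conditions of the
  difference equations.\<close>

lemma mult_pinv_mult_of_range:
  fixes A :: "real^'n^'n"
  assumes "transpose A = A" "A *v x = b"
  shows "A *v (pinv A *v b) = b"
  using is_pinv_pinv[OF assms(1)] unfolding assms(2)[symmetric] is_pinv_def
  by (simp add: matrix_vector_mul_assoc matrix_mul_assoc)

text \<open>Otherwise a short move from \<open>v\<close> along \<open>- (A *v v)\<close> would make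
  the quadratic form negative, because its value at \<open>v\<close> is zero and its first-order
  change is strictly negative.\<close>

lemma psd_mult_eq_0:
  assumes "psd A" "v \<bullet> (A *v v) = 0"
  shows "A *v v = 0"
proof -
  let ?w = "A *v v"
  let ?c = "?w \<bullet> (A *v ?w)"
  have sym: "transpose A = A" and nn: "\<And>x. 0 \<le> x \<bullet> (A *v x)"
    using assms(1) by (auto simp: psd_def)
  have c: "0 \<le> ?c" by (rule nn)
  \<comment> \<open>The denominator \<open>?c + 1\<close> is positive even for
    \<open>?c = 0\<close>, and this step length keeps the second-order term
    \<open>t * (t * ?c)\<close> below half of the first-order gain
    \<open>2 * t * (?w \<bullet> ?w)\<close>.\<close>
  define t where "t = (?w \<bullet> ?w) / (?c + 1)"
  have t: "0 \<le> t" "t * ?c \<le> ?w \<bullet> ?w" "?w \<bullet> ?w = t * (?c + 1)"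
    using c by (auto simp: t_def field_simps)
  have vw: "v \<bullet> (A *v ?w) = ?w \<bullet> ?w"
    using symmetric_inner_mult[OF sym, of v ?w] by simp
  have "(v - t *\<^sub>R ?w) \<bullet> (A *v (v - t *\<^sub>R ?w)) = t * (t * ?c) - 2 * t * (?w \<bullet> ?w)"
    using assms(2) vw
    by (simp add: matrix_vector_mult_diff_distrib matrix_vector_mult_scaleR
        inner_diff_left inner_diff_right inner_commute algebra_simps)
  with nn[of "v - t *\<^sub>R ?w"] have "2 * t * (?w \<bullet> ?w) \<le> t * (t * ?c)" by simp
  also have "\<dots> \<le> t * (?w \<bullet> ?w)" using t by (intro mult_left_mono) auto
  finally have "t * (?w \<bullet> ?w) \<le> 0" by simp
  then have "t = 0 \<or> ?w \<bullet> ?w \<le> 0" using t(1) by (auto simp: mult_le_0_iff)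
  then have "?w \<bullet> ?w = 0" using t(3) inner_ge_zero[of ?w] by auto
  then show ?thesis by simp
qed

lemma outer_mult: "outer a b *v x = (b \<bullet> x) *\<^sub>R a"
  by (simp add: vec_eq_iff outer_def matrix_vector_mult_def inner_vec_def sum_distrib_left
      mult.commute mult.left_commute)

lemma scaleR_matrix_vector_mult: "(c *\<^sub>R A) *v x = c *\<^sub>R (A *v (x::real^'n))"
  by (simp add: vec_eq_iff matrix_vector_mult_def sum_distrib_left mult.assoc)

lemma transpose_outer: "transpose (outer a a) = outer a a"
  by (simp add: vec_eq_iff outer_def transpose_def mult.commute)

lemma transpose_add_matrix: "transpose (A + B) = transpose A + transpose B"
  by (simp add: vec_eq_iff transpose_def)

lemma transpose_scaleR_matrix: "transpose (c *\<^sub>R A) = c *\<^sub>R transpose A"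
  by (simp add: vec_eq_iff transpose_def)

section \<open>Square-integrable random variables and conditional expectations\<close>

lemma l2_measurable: "u \<in> l2 M F \<Longrightarrow> u \<in> borel_measurable F"
  by (simp add: l2_def)

lemma l2_integrable: "u \<in> l2 M F \<Longrightarrow> integrable M (\<lambda>\<omega>. (norm (u \<omega>))\<^sup>2)"
  by (simp add: l2_def)

lemma l2_measurable_subalg:
  assumes "subalgebra M F" "u \<in> l2 M F"
  shows "u \<in> borel_measurable M"
  using measurable_from_subalg[OF assms(1) l2_measurable[OF assms(2)]] .

lemma l2_mono:
  assumes "subalgebra G F" "u \<in> l2 M F"
  shows "u \<in> l2 M G"
  using assms measurable_from_subalg[OF assms(1)] by (auto simp: l2_def)

text \<open>This single closure property serves for coordinates, scalar multiples, inner products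
  with a fixed vector and matrix images.\<close>

lemma l2_bounded_linear:
  assumes F: "subalgebra M F" and f: "bounded_linear f" and u: "u \<in> l2 M F"
  shows "(\<lambda>\<omega>. f (u \<omega>)) \<in> l2 M F"
proof -
  obtain K where K: "\<And>x. norm (f x) \<le> norm x * K"
    using bounded_linear.bounded[OF f] by blast
  have fm: "f \<in> borel_measurable borel"
    using linear_continuous_on[OF f] by (rule borel_measurable_continuous_onI)
  have meas: "(\<lambda>\<omega>. f (u \<omega>)) \<in> borel_measurable F"
    by (rule measurable_compose[OF l2_measurable[OF u] fm])
  have [measurable]: "(\<lambda>\<omega>. f (u \<omega>)) \<in> borel_measurable M"
    using measurable_from_subalg[OF F meas] .
  have "integrable M (\<lambda>\<omega>. (norm (f (u \<omega>)))\<^sup>2)"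
  proof (rule Bochner_Integration.integrable_bound)
    show "integrable M (\<lambda>\<omega>. K\<^sup>2 * (norm (u \<omega>))\<^sup>2)"
      using l2_integrable[OF u] by simp
    have "(norm (f x))\<^sup>2 \<le> K\<^sup>2 * (norm x)\<^sup>2" for x
      using power_mono[OF K[of x] norm_ge_zero, of 2] by (simp add: power_mult_distrib mult.commute)
    then show "AE \<omega> in M. norm ((norm (f (u \<omega>)))\<^sup>2) \<le> norm (K\<^sup>2 * (norm (u \<omega>))\<^sup>2)"
      by simp
  qed simp
  with meas show ?thesis by (simp add: l2_def)
qed

lemma l2_add:
  assumes F: "subalgebra M F" and u: "u \<in> l2 M F" and v: "v \<in> l2 M F"
  shows "(\<lambda>\<omega>. u \<omega> + v \<omega>) \<in> l2 M F"
proof -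
  have [measurable]: "u \<in> borel_measurable M" "v \<in> borel_measurable M"
    using l2_measurable_subalg F u v by auto
  have "integrable M (\<lambda>\<omega>. (norm (u \<omega> + v \<omega>))\<^sup>2)"
  proof (rule Bochner_Integration.integrable_bound)
    show "integrable M (\<lambda>\<omega>. 2 * (norm (u \<omega>))\<^sup>2 + 2 * (norm (v \<omega>))\<^sup>2)"
      using l2_integrable[OF u] l2_integrable[OF v] by simp
    have "(norm (a + b))\<^sup>2 \<le> 2 * (norm a)\<^sup>2 + 2 * (norm b)\<^sup>2" for a b :: 'b
    proof -
      have "(norm (a + b))\<^sup>2 \<le> (norm a + norm b)\<^sup>2"
        by (intro power_mono norm_triangle_ineq norm_ge_zero)
      also have "\<dots> \<le> 2 * (norm a)\<^sup>2 + 2 * (norm b)\<^sup>2"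
        using zero_le_power2[of "norm a - norm b"] by (simp add: power2_eq_square algebra_simps)
      finally show ?thesis .
    qed
    then show "AE \<omega> in M. norm ((norm (u \<omega> + v \<omega>))\<^sup>2) \<le> norm (2 * (norm (u \<omega>))\<^sup>2 + 2 * (norm (v \<omega>))\<^sup>2)"
      by simp
  qed simp
  moreover have "(\<lambda>\<omega>. u \<omega> + v \<omega>) \<in> borel_measurable F"
    using l2_measurable[OF u] l2_measurable[OF v] by simp
  ultimately show ?thesis by (simp add: l2_def)
qed

lemma l2_mult_integrable:
  fixes u v :: "'a \<Rightarrow> real"
  assumes F: "subalgebra M F" and u: "u \<in> l2 M F" and v: "v \<in> l2 M F"
  shows "integrable M (\<lambda>\<omega>. u \<omega> * v \<omega>)"
proof (rule Bochner_Integration.integrable_bound)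
  have [measurable]: "u \<in> borel_measurable M" "v \<in> borel_measurable M"
    using l2_measurable_subalg F u v by auto
  show "integrable M (\<lambda>\<omega>. (norm (u \<omega>))\<^sup>2 + (norm (v \<omega>))\<^sup>2)"
    using l2_integrable[OF u] l2_integrable[OF v] by simp
  have "\<bar>a * b\<bar> \<le> a\<^sup>2 + b\<^sup>2" for a b :: real
  proof -
    have "2 * (\<bar>a\<bar> * \<bar>b\<bar>) \<le> a\<^sup>2 + b\<^sup>2"
      using zero_le_power2[of "\<bar>a\<bar> - \<bar>b\<bar>"] by (simp add: power2_diff)
    moreover have "0 \<le> \<bar>a\<bar> * \<bar>b\<bar>" by simp
    ultimately show ?thesis unfolding abs_mult by linarith
  qed
  then show "AE \<omega> in M. norm (u \<omega> * v \<omega>) \<le> norm ((norm (u \<omega>))\<^sup>2 + (norm (v \<omega>))\<^sup>2)"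
    by simp
  show "(\<lambda>\<omega>. u \<omega> * v \<omega>) \<in> borel_measurable M" by simp
qed

lemma (in prob_space) l2_const: "(\<lambda>_. c) \<in> l2 M F"
  by (simp add: l2_def)

lemma (in prob_space) l2_real_integrable:
  fixes u :: "'a \<Rightarrow> real"
  assumes F: "subalgebra M F" and u: "u \<in> l2 M F"
  shows "integrable M u"
  using l2_mult_integrable[OF F u l2_const[of 1]] by simp

section \<open>The filtration of past returns and its independence of the next return\<close>

lemma space_filt: "space (filt M e k) = space M"
  by (simp add: filt_def space_measure_of_conv)

lemma sets_filt:
  "sets (filt M e k) = sigma_sets (space M) (\<Union>l<k. {e l -` B \<inter> space M | B. B \<in> sets borel})"
  unfolding filt_def by (rule sets_measure_of) auto

lemma subalgebra_filt_filt: "k \<le> l \<Longrightarrow> subalgebra (filt M e l) (filt M e k)"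
  unfolding subalgebra_def space_filt sets_filt
  by (intro conjI refl sigma_sets_mono') force

lemma measurable_filt: "l < k \<Longrightarrow> e l \<in> borel_measurable (filt M e k)"
  by (intro measurableI) (auto simp: space_filt sets_filt intro!: sigma_sets.Basic)

lemma excess_eq: "excess s e k \<omega> = e k \<omega> - (\<chi> i. s k)"
  by (simp add: excess_def vec_eq_iff)

locale market = prob_space M for M :: "'a measure" +
  fixes N :: nat and s :: "nat \<Rightarrow> real" and e :: "nat \<Rightarrow> 'a \<Rightarrow> real^'m"
  assumes indep: "indep_vars (\<lambda>_. borel) e {..<N}"
    and square_integrable: "\<And>k. k < N \<Longrightarrow> integrable M (\<lambda>\<omega>. (norm (e k \<omega>))\<^sup>2)"
begin

abbreviation ret :: "nat \<Rightarrow> 'a \<Rightarrow> real^'m" where "ret \<equiv> excess s e"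
abbreviation mean_ret :: "nat \<Rightarrow> real^'m" where "mean_ret k \<equiv> \<integral>\<omega>. ret k \<omega> \<partial>M"
abbreviation cov_ret :: "nat \<Rightarrow> real^'m^'m" where "cov_ret k \<equiv> cov_mat M (ret k)"
abbreviation Fk :: "nat \<Rightarrow> 'a measure" where "Fk \<equiv> filt M e"

lemma measurable_e: "k < N \<Longrightarrow> e k \<in> borel_measurable M"
  using indep by (simp add: indep_vars_def2)

lemma subalgebra_Fk: "k \<le> N \<Longrightarrow> subalgebra M (Fk k)"
  unfolding subalgebra_def space_filt sets_filt
  by (intro conjI refl sets.sigma_sets_subset) (auto intro!: measurable_sets[OF measurable_e])

lemma sigma_finite_subalg: "k \<le> N \<Longrightarrow> sigma_finite_subalgebra M (Fk k)"
  using subalgebra_Fk finite_measure_axioms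
  by (intro finite_measure_subalgebra_is_sigma_finite)
     (simp add: finite_measure_subalgebra_def finite_measure_subalgebra_axioms_def)

text \<open>The returns before stage \<open>k\<close> and the return \<open>e k\<close> are disjoint
  blocks of an independent family, so they generate independent sigma-algebras; \<open>u\<close> is
  measurable for the first and \<open>g (e k)\<close> for the second.\<close>

lemma indep_var_filt:
  fixes u :: "'a \<Rightarrow> real" and g :: "real^'m \<Rightarrow> real"
  assumes k: "k < N" and u: "u \<in> borel_measurable (Fk k)" and g: "g \<in> borel_measurable borel"
  shows "indep_var borel u borel (\<lambda>\<omega>. g (e k \<omega>))"
proof -
  let ?E = "\<lambda>i. {e i -` A \<inter> space M | A. A \<in> sets borel}"
  let ?G = "{(\<lambda>\<omega>. g (e k \<omega>)) -` A \<inter> space M | A. A \<in> sets borel}"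
  \<comment> \<open>\<open>True\<close> indexes the block of past stages, \<open>False\<close> the
    block consisting of \<open>k\<close> alone.\<close>
  let ?I = "\<lambda>b. case b of True \<Rightarrow> {..<k} | False \<Rightarrow> {k}"
  have "indep_sets (\<lambda>b. sigma_sets (space M) (\<Union>i\<in>?I b. ?E i)) UNIV"
  proof (rule indep_sets_collect_sigma)
    show "indep_sets ?E (\<Union>b. ?I b)"
      using indep k unfolding indep_vars_def2
      by (auto intro!: indep_sets_mono_index[of _ "{..<N}"] simp: UNIV_bool)
    show "Int_stable (?E i)" for i
      unfolding Int_stable_def by (auto, rule_tac x="A \<inter> Aa" in exI) auto
    show "disjoint_family_on ?I UNIV"
      by (auto simp: disjoint_family_on_def split: bool.splits)
  qed
  then have "indep_set (sigma_sets (space M) {u -` A \<inter> space M | A. A \<in> sets borel})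
     (sigma_sets (space M) ?G)"
    unfolding indep_set_def
  proof (rule indep_sets_mono_sets)
    fix b :: bool
    have "{u -` A \<inter> space M | A. A \<in> sets borel} \<subseteq> sets (Fk k)"
      using measurable_sets[OF u] by (auto simp: space_filt)
    then have "sigma_sets (space M) {u -` A \<inter> space M | A. A \<in> sets borel} \<subseteq> sets (Fk k)"
      using sets.sigma_sets_subset[of _ "Fk k"] by (simp add: space_filt)
    moreover have "?G \<subseteq> ?E k"
    proof safe
      fix A :: "real set" assume "A \<in> sets borel"
      then have "g -` A \<in> sets borel" using measurable_sets[OF g, of A] by simp
      then show "\<exists>B. (\<lambda>\<omega>. g (e k \<omega>)) -` A \<inter> space M = e k -` B \<inter> space M \<and> B \<in> sets borel"
        by (intro exI[of _ "g -` A"]) auto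
    qed
    then have "sigma_sets (space M) ?G \<subseteq> sigma_sets (space M) (?E k)"
      by (rule sigma_sets_mono')
    ultimately show "(case b of True \<Rightarrow> sigma_sets (space M) {u -` A \<inter> space M | A. A \<in> sets borel}
        | False \<Rightarrow> sigma_sets (space M) ?G) \<subseteq> sigma_sets (space M) (\<Union>i\<in>?I b. ?E i)"
      by (cases b) (simp_all add: sets_filt)
  qed
  then show ?thesis
    using measurable_from_subalg[OF subalgebra_Fk u] measurable_compose[OF measurable_e g] k
    by (simp add: indep_var_eq)
qed

section \<open>Calculus of conditional expectations\<close>

text \<open>Conditional expectations are determined only almost everywhere, and their rules require
  integrability. Carrying both facts in one predicate lets the rules below be chained without
  separate side conditions.\<close>

definition cond_exp_is :: "nat \<Rightarrow> ('a \<Rightarrow> real) \<Rightarrow> ('a \<Rightarrow> real) \<Rightarrow> bool" where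
  "cond_exp_is k f g \<longleftrightarrow> integrable M f \<and> (AE \<omega> in M. real_cond_exp M (Fk k) f \<omega> = g \<omega>)"

lemma cond_exp_is_add:
  assumes "k \<le> N" "cond_exp_is k f g" "cond_exp_is k f' g'"
  shows "cond_exp_is k (\<lambda>\<omega>. f \<omega> + f' \<omega>) (\<lambda>\<omega>. g \<omega> + g' \<omega>)"
  using sigma_finite_subalgebra.real_cond_exp_add[OF sigma_finite_subalg, of k f f'] assms
  unfolding cond_exp_is_def by auto

lemma cond_exp_is_self:
  assumes "k \<le> N" "f \<in> borel_measurable (Fk k)" "integrable M f"
  shows "cond_exp_is k f f"
  using sigma_finite_subalgebra.real_cond_exp_F_meas[OF sigma_finite_subalg, of k f] assms
  unfolding cond_exp_is_def by auto

lemma cond_exp_is_mult: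
  assumes "k \<le> N" "z \<in> borel_measurable (Fk k)" "integrable M (\<lambda>\<omega>. z \<omega> * f \<omega>)" "cond_exp_is k f g"
  shows "cond_exp_is k (\<lambda>\<omega>. z \<omega> * f \<omega>) (\<lambda>\<omega>. z \<omega> * g \<omega>)"
  using sigma_finite_subalgebra.real_cond_exp_mult[OF sigma_finite_subalg, of k z f] assms
  unfolding cond_exp_is_def by auto

lemma cond_exp_is_cmult:
  assumes "k \<le> N" "cond_exp_is k f g"
  shows "cond_exp_is k (\<lambda>\<omega>. c * f \<omega>) (\<lambda>\<omega>. c * g \<omega>)"
  using assms by (intro cond_exp_is_mult) (auto simp: cond_exp_is_def)

lemma cond_exp_is_const: "k \<le> N \<Longrightarrow> cond_exp_is k (\<lambda>_. c) (\<lambda>_. c)"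
  by (intro cond_exp_is_self) auto

lemma cond_exp_is_sum:
  assumes "k \<le> N" "\<And>i. i \<in> I \<Longrightarrow> cond_exp_is k (f i) (g i)"
  shows "cond_exp_is k (\<lambda>\<omega>. \<Sum>i\<in>I. f i \<omega>) (\<lambda>\<omega>. \<Sum>i\<in>I. g i \<omega>)"
  using assms(2)
proof (induction I rule: infinite_finite_induct)
  case (insert x I)
  then have "cond_exp_is k (\<lambda>\<omega>. f x \<omega> + (\<Sum>i\<in>I. f i \<omega>)) (\<lambda>\<omega>. g x \<omega> + (\<Sum>i\<in>I. g i \<omega>))"
    by (intro cond_exp_is_add[OF assms(1)] insert.IH insert.prems) simp_all
  then show ?case using insert.hyps by simp
qed (simp_all add: cond_exp_is_const[OF assms(1)])

lemma cond_exp_is_AE_eq: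
  assumes "cond_exp_is k f g" "AE \<omega> in M. g \<omega> = g' \<omega>"
  shows "cond_exp_is k f g'"
  using assms unfolding cond_exp_is_def by auto

text \<open>Conditioning \<open>f\<close> on stage \<open>k\<close> passes through stage
  \<open>l\<close>, where the conditional expectation may be replaced by its version
  \<open>g\<close>.\<close>

lemma cond_exp_is_tower:
  assumes k: "k \<le> l" "l \<le> N" and f: "cond_exp_is l f g" and g: "cond_exp_is k g h"
  shows "cond_exp_is k f h"
proof -
  have k': "k \<le> N" using k by simp
  have int: "integrable M f" "integrable M g" using f g by (auto simp: cond_exp_is_def)
  have "AE \<omega> in M. real_cond_exp M (Fk k) (real_cond_exp M (Fk l) f) \<omega> = real_cond_exp M (Fk k) f \<omega>"
    by (intro sigma_finite_subalgebra.real_cond_exp_nested_subalg sigma_finite_subalg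
        subalgebra_Fk subalgebra_filt_filt k k' int)
  moreover have "AE \<omega> in M. real_cond_exp M (Fk k) (real_cond_exp M (Fk l) f) \<omega> = real_cond_exp M (Fk k) g \<omega>"
    using f int
    by (intro sigma_finite_subalgebra.real_cond_exp_cong sigma_finite_subalg k')
       (auto simp: cond_exp_is_def borel_measurable_cond_exp2)
  ultimately show ?thesis
    using g int unfolding cond_exp_is_def by auto
qed

text \<open>This is where independence of the returns enters the conditional moments. The candidate
  is checked against the defining integrals over sets of \<open>Fk k\<close>.\<close>

lemma cond_exp_is_mult_indep:
  fixes u :: "'a \<Rightarrow> real" and g :: "real^'m \<Rightarrow> real"
  assumes k: "k < N" and u: "u \<in> borel_measurable (Fk k)" "integrable M u"
    and g: "g \<in> borel_measurable borel" "integrable M (\<lambda>\<omega>. g (e k \<omega>))"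
  shows "cond_exp_is k (\<lambda>\<omega>. u \<omega> * g (e k \<omega>)) (\<lambda>\<omega>. u \<omega> * (\<integral>\<xi>. g (e k \<xi>) \<partial>M))"
proof -
  interpret sigma_finite_subalgebra M "Fk k" using sigma_finite_subalg k by simp
  have int: "integrable M (\<lambda>\<omega>. u \<omega> * g (e k \<omega>))"
    using indep_var_integrable[OF indep_var_filt[OF k u(1) g(1)] u(2) g(2)] .
  have "AE \<omega> in M. real_cond_exp M (Fk k) (\<lambda>\<omega>. u \<omega> * g (e k \<omega>)) \<omega> = u \<omega> * (\<integral>\<xi>. g (e k \<xi>) \<partial>M)"
  proof (rule real_cond_exp_charact)
    fix A assume A: "A \<in> sets (Fk k)"
    then have AM: "A \<in> sets M" using subalgebra_Fk[of k] k by (auto simp: subalgebra_def)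
    \<comment> \<open>The indicator of \<open>A\<close> is absorbed into the
      \<open>Fk k\<close>-measurable factor, so the product formula for expectations also gives the
      integrals over \<open>A\<close>.\<close>
    have uA: "(\<lambda>\<omega>. indicator A \<omega> * u \<omega>) \<in> borel_measurable (Fk k)"
      using u A by simp
    have uAi: "integrable M (\<lambda>\<omega>. indicator A \<omega> * u \<omega>)"
      using integrable_mult_indicator[OF AM u(2)] by simp
    show "(\<integral>\<omega>\<in>A. u \<omega> * g (e k \<omega>) \<partial>M) = (\<integral>\<omega>\<in>A. u \<omega> * (\<integral>\<xi>. g (e k \<xi>) \<partial>M) \<partial>M)"
      using indep_var_lebesgue_integral[OF indep_var_filt[OF k uA g(1)] uAi g(2)]
      by (simp add: set_lebesgue_integral_def mult.assoc)
  qed (use int u in auto)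
  then show ?thesis using int by (simp add: cond_exp_is_def)
qed

section \<open>Moments of the excess returns and of the next wealth\<close>

lemma ret_in_l2: "k < N \<Longrightarrow> ret k \<in> l2 M (Fk (Suc k))"
proof -
  assume k: "k < N"
  then have sub: "subalgebra M (Fk (Suc k))" by (intro subalgebra_Fk) simp
  \<comment> \<open>\<open>Fk k\<close> is generated by the returns with index below
    \<open>k\<close>, so \<open>e k\<close> is observed only from \<open>Suc k\<close> on.\<close>
  have "e k \<in> l2 M (Fk (Suc k))"
    using square_integrable[OF k] measurable_filt[of k "Suc k" e M] by (simp add: l2_def)
  from l2_add[OF sub this l2_const[of "- (\<chi> i. s k)"]]
  show ?thesis by (simp add: excess_eq[abs_def])
qed

lemma ret_component_in_l2: "k < N \<Longrightarrow> (\<lambda>\<omega>. ret k \<omega> $ i) \<in> l2 M (Fk (Suc k))"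
  using l2_bounded_linear[OF subalgebra_Fk bounded_linear_vec_nth ret_in_l2] by (simp add: Suc_le_eq)

lemma integrable_ret_component: "k < N \<Longrightarrow> integrable M (\<lambda>\<omega>. ret k \<omega> $ i)"
  using l2_real_integrable[OF subalgebra_Fk ret_component_in_l2] by (simp add: Suc_le_eq)

lemma integrable_ret_mult: "k < N \<Longrightarrow> integrable M (\<lambda>\<omega>. ret k \<omega> $ i * ret k \<omega> $ j)"
  using l2_mult_integrable[OF subalgebra_Fk ret_component_in_l2 ret_component_in_l2] by (simp add: Suc_le_eq)

lemma integrable_ret:
  assumes k: "k < N"
  shows "integrable M (ret k)"
proof -
  have m[measurable]: "ret k \<in> borel_measurable M"
    using l2_measurable_subalg[OF subalgebra_Fk ret_in_l2[OF k]] k by simp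
  have "integrable M (\<lambda>\<omega>. norm (ret k \<omega>))"
    by (rule square_integrable_imp_integrable)
       (use l2_integrable[OF ret_in_l2[OF k]] in simp_all)
  then show ?thesis by (simp add: integrable_norm_iff)
qed

lemma mean_ret_component: "k < N \<Longrightarrow> mean_ret k $ i = (\<integral>\<omega>. ret k \<omega> $ i \<partial>M)"
  using integral_bounded_linear[OF bounded_linear_vec_nth integrable_ret, of k i] by simp

lemma second_moment_ret:
  assumes k: "k < N"
  shows "second_moment M (ret k) = cov_ret k + outer (mean_ret k) (mean_ret k)"
proof -
  have "cov_ret k $ i $ j = second_moment M (ret k) $ i $ j - mean_ret k $ i * mean_ret k $ j" for i j
  proof -
    let ?a = "mean_ret k $ i" and ?b = "mean_ret k $ j"
    have "cov_ret k $ i $ j = (\<integral>\<omega>. (ret k \<omega> $ i - ?a) * (ret k \<omega> $ j - ?b) \<partial>M)"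
      by (simp add: cov_mat_def second_moment_def)
    also have "\<dots> = (\<integral>\<omega>. ret k \<omega> $ i * ret k \<omega> $ j - ?b * ret k \<omega> $ i - ?a * ret k \<omega> $ j + ?a * ?b \<partial>M)"
      by (intro Bochner_Integration.integral_cong) (simp_all add: algebra_simps)
    also have "\<dots> = second_moment M (ret k) $ i $ j - ?b * ?a - ?a * ?b + ?a * ?b"
      using integrable_ret_mult[OF k, of i j] integrable_ret_component[OF k, of i]
        integrable_ret_component[OF k, of j]
      by (simp add: second_moment_def mean_ret_component[OF k] prob_space)
    finally show ?thesis by simp
  qed
  then show ?thesis by (simp add: vec_eq_iff outer_def)
qed

text \<open>The quadratic form at \<open>v\<close> is the expected square of the centred return in
  direction \<open>v\<close>.\<close>

lemma psd_cov_ret: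
  assumes k: "k < N"
  shows "psd (cov_ret k)"
proof -
  let ?Z = "\<lambda>\<omega>. ret k \<omega> - mean_ret k"
  have Z: "?Z \<in> l2 M (Fk (Suc k))"
    using l2_add[OF subalgebra_Fk ret_in_l2[OF k] l2_const[of "- mean_ret k"]] k by simp
  have Zi: "(\<lambda>\<omega>. ?Z \<omega> $ i) \<in> l2 M (Fk (Suc k))" for i
    using l2_bounded_linear[OF subalgebra_Fk bounded_linear_vec_nth Z] k by simp
  have int: "integrable M (\<lambda>\<omega>. ?Z \<omega> $ i * ?Z \<omega> $ j)" for i j
    using l2_mult_integrable[OF subalgebra_Fk Zi Zi] k by simp
  have "transpose (cov_ret k) = cov_ret k"
    by (simp add: vec_eq_iff transpose_def cov_mat_def second_moment_def mult.commute)
  moreover have "v \<bullet> (cov_ret k *v v) = (\<integral>\<omega>. (?Z \<omega> \<bullet> v)\<^sup>2 \<partial>M)" for v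
  proof -
    have "(?Z \<omega> \<bullet> v)\<^sup>2 = (\<Sum>i\<in>UNIV. \<Sum>j\<in>UNIV. (v $ i * v $ j) * (?Z \<omega> $ i * ?Z \<omega> $ j))" for \<omega>
      by (simp add: inner_vec_def power2_eq_square sum_product mult_ac)
    then have "(\<integral>\<omega>. (?Z \<omega> \<bullet> v)\<^sup>2 \<partial>M) = (\<Sum>i\<in>UNIV. \<Sum>j\<in>UNIV. (v $ i * v $ j) * (\<integral>\<omega>. ?Z \<omega> $ i * ?Z \<omega> $ j \<partial>M))"
      using int by (simp add: Bochner_Integration.integral_sum Bochner_Integration.integrable_sum del: vector_minus_component)
    also have "\<dots> = v \<bullet> (cov_ret k *v v)"
      by (simp add: cov_mat_def second_moment_def inner_vec_def matrix_vector_mult_def sum_distrib_left mult_ac)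
    finally show ?thesis by simp
  qed
  ultimately show ?thesis by (simp add: psd_def)
qed

lemma cond_exp_is_mult_ret:
  assumes k: "k < N" and u: "u \<in> borel_measurable (Fk k)" "integrable M u"
  shows "cond_exp_is k (\<lambda>\<omega>. u \<omega> * ret k \<omega> $ i) (\<lambda>\<omega>. u \<omega> * mean_ret k $ i)"
  using cond_exp_is_mult_indep[OF k u, of "\<lambda>v. v $ i - s k"] integrable_ret_component[OF k, of i]
  unfolding mean_ret_component[OF k] by (simp add: excess_def)

lemma cond_exp_is_mult_ret_ret:
  assumes k: "k < N" and u: "u \<in> borel_measurable (Fk k)" "integrable M u"
  shows "cond_exp_is k (\<lambda>\<omega>. u \<omega> * (ret k \<omega> $ i * ret k \<omega> $ j))
     (\<lambda>\<omega>. u \<omega> * second_moment M (ret k) $ i $ j)"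
  using cond_exp_is_mult_indep[OF k u, of "\<lambda>v. (v $ i - s k) * (v $ j - s k)"] integrable_ret_mult[OF k, of i j]
  by (simp add: excess_def second_moment_def)

text \<open>Inner products and squares are expanded into coordinates, where the scalar rules for
  independent factors apply. The mixed second moments then reassemble into the covariance form plus
  the squared mean.\<close>

lemma
  assumes k: "k < N" and y: "y \<in> l2 M (Fk k)" and u: "u \<in> l2 M (Fk k)"
  shows next_wealth_in_l2: "(\<lambda>\<omega>. s k * y \<omega> + ret k \<omega> \<bullet> u \<omega>) \<in> l2 M (Fk (Suc k))"
    and cond_exp_next_wealth:
      "cond_exp_is k (\<lambda>\<omega>. s k * y \<omega> + ret k \<omega> \<bullet> u \<omega>) (\<lambda>\<omega>. s k * y \<omega> + mean_ret k \<bullet> u \<omega>)"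
    and cond_exp_next_wealth_sq:
      "cond_exp_is k (\<lambda>\<omega>. (s k * y \<omega> + ret k \<omega> \<bullet> u \<omega>)\<^sup>2)
         (\<lambda>\<omega>. (s k * y \<omega> + mean_ret k \<bullet> u \<omega>)\<^sup>2 + u \<omega> \<bullet> (cov_ret k *v u \<omega>))"
proof -
  have k': "k \<le> N" "Suc k \<le> N" using k by auto
  note subk = subalgebra_Fk[OF k'(1)] and subSk = subalgebra_Fk[OF k'(2)]
  have ui: "(\<lambda>\<omega>. u \<omega> $ i) \<in> l2 M (Fk k)" for i
    using l2_bounded_linear[OF subk bounded_linear_vec_nth u] .
  have uim[measurable]: "(\<lambda>\<omega>. u \<omega> $ i) \<in> borel_measurable (Fk k)" for i by (rule l2_measurable[OF ui])
  have ym[measurable]: "y \<in> borel_measurable (Fk k)" by (rule l2_measurable[OF y])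
  have inty: "integrable M (\<lambda>\<omega>. y \<omega> * y \<omega>)" by (rule l2_mult_integrable[OF subk y y])
  have intyu: "integrable M (\<lambda>\<omega>. y \<omega> * u \<omega> $ i)" for i by (rule l2_mult_integrable[OF subk y ui])
  have intuu: "integrable M (\<lambda>\<omega>. u \<omega> $ i * u \<omega> $ j)" for i j by (rule l2_mult_integrable[OF subk ui ui])
  have ce1: "cond_exp_is k (\<lambda>\<omega>. ret k \<omega> \<bullet> u \<omega>) (\<lambda>\<omega>. mean_ret k \<bullet> u \<omega>)"
  proof -
    have "cond_exp_is k (\<lambda>\<omega>. \<Sum>i\<in>UNIV. u \<omega> $ i * ret k \<omega> $ i) (\<lambda>\<omega>. \<Sum>i\<in>UNIV. u \<omega> $ i * mean_ret k $ i)"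
      using l2_real_integrable[OF subk ui] uim
      by (intro cond_exp_is_sum k' cond_exp_is_mult_ret k) auto
    then show ?thesis by (simp add: inner_vec_def mult.commute)
  qed
  have cey: "cond_exp_is k y y"
    using l2_real_integrable[OF subk y] ym by (intro cond_exp_is_self k') auto
  show "cond_exp_is k (\<lambda>\<omega>. s k * y \<omega> + ret k \<omega> \<bullet> u \<omega>) (\<lambda>\<omega>. s k * y \<omega> + mean_ret k \<bullet> u \<omega>)"
    by (intro cond_exp_is_add cond_exp_is_cmult k' cey ce1)
  have ce2: "cond_exp_is k (\<lambda>\<omega>. (ret k \<omega> \<bullet> u \<omega>)\<^sup>2)
      (\<lambda>\<omega>. (mean_ret k \<bullet> u \<omega>)\<^sup>2 + u \<omega> \<bullet> (cov_ret k *v u \<omega>))"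
  proof -
    have "cond_exp_is k (\<lambda>\<omega>. \<Sum>i\<in>UNIV. \<Sum>j\<in>UNIV. (u \<omega> $ i * u \<omega> $ j) * (ret k \<omega> $ i * ret k \<omega> $ j))
       (\<lambda>\<omega>. \<Sum>i\<in>UNIV. \<Sum>j\<in>UNIV. (u \<omega> $ i * u \<omega> $ j) * second_moment M (ret k) $ i $ j)"
      by (intro cond_exp_is_sum k' cond_exp_is_mult_ret_ret k intuu) simp
    moreover have "(\<Sum>i\<in>UNIV. \<Sum>j\<in>UNIV. (u \<omega> $ i * u \<omega> $ j) * (ret k \<omega> $ i * ret k \<omega> $ j)) = (ret k \<omega> \<bullet> u \<omega>)\<^sup>2" for \<omega>
      by (simp add: inner_vec_def power2_eq_square sum_product mult_ac)
    moreover have "(\<Sum>i\<in>UNIV. \<Sum>j\<in>UNIV. (u \<omega> $ i * u \<omega> $ j) * second_moment M (ret k) $ i $ j)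
        = u \<omega> \<bullet> (second_moment M (ret k) *v u \<omega>)" for \<omega>
      by (simp add: inner_vec_def matrix_vector_mult_def sum_distrib_left mult_ac)
    ultimately show ?thesis
      by (simp add: second_moment_ret[OF k] matrix_vector_mult_add_rdistrib outer_mult inner_add_right
          power2_eq_square inner_commute add.commute)
  qed
  have ce3: "cond_exp_is k (\<lambda>\<omega>. y \<omega> * (ret k \<omega> \<bullet> u \<omega>)) (\<lambda>\<omega>. y \<omega> * (mean_ret k \<bullet> u \<omega>))"
  proof -
    have "cond_exp_is k (\<lambda>\<omega>. \<Sum>i\<in>UNIV. (y \<omega> * u \<omega> $ i) * ret k \<omega> $ i) (\<lambda>\<omega>. \<Sum>i\<in>UNIV. (y \<omega> * u \<omega> $ i) * mean_ret k $ i)"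
      by (intro cond_exp_is_sum k' cond_exp_is_mult_ret k intyu) simp
    then show ?thesis by (simp add: inner_vec_def sum_distrib_left mult_ac)
  qed
  have "cond_exp_is k (\<lambda>\<omega>. (s k)\<^sup>2 * (y \<omega> * y \<omega>) + (2 * s k) * (y \<omega> * (ret k \<omega> \<bullet> u \<omega>)) + (ret k \<omega> \<bullet> u \<omega>)\<^sup>2)
     (\<lambda>\<omega>. (s k)\<^sup>2 * (y \<omega> * y \<omega>) + (2 * s k) * (y \<omega> * (mean_ret k \<bullet> u \<omega>))
        + ((mean_ret k \<bullet> u \<omega>)\<^sup>2 + u \<omega> \<bullet> (cov_ret k *v u \<omega>)))"
    by (intro cond_exp_is_add cond_exp_is_cmult k' ce2 ce3 cond_exp_is_self inty) simp
  then show sq: "cond_exp_is k (\<lambda>\<omega>. (s k * y \<omega> + ret k \<omega> \<bullet> u \<omega>)\<^sup>2)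
         (\<lambda>\<omega>. (s k * y \<omega> + mean_ret k \<bullet> u \<omega>)\<^sup>2 + u \<omega> \<bullet> (cov_ret k *v u \<omega>))"
    by (simp add: power2_eq_square algebra_simps)
  have "(\<lambda>\<omega>. s k * y \<omega> + ret k \<omega> \<bullet> u \<omega>) \<in> borel_measurable (Fk (Suc k))"
    using l2_measurable[OF ret_in_l2[OF k]]
      l2_measurable[OF l2_mono[OF subalgebra_filt_filt u], of "Suc k"]
      l2_measurable[OF l2_mono[OF subalgebra_filt_filt y], of "Suc k"] by simp
  \<comment> \<open>A product of two square-integrable variables need not be square-integrable; here
    independence makes it so, and the integrability part of \<open>sq\<close> records this.\<close>
  then show "(\<lambda>\<omega>. s k * y \<omega> + ret k \<omega> \<bullet> u \<omega>) \<in> l2 M (Fk (Suc k))"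
    using sq by (simp add: l2_def cond_exp_is_def)
qed

end

section \<open>Costs of feedback strategies\<close>

lemma fb_wealth_initial: "j \<le> t \<Longrightarrow> fb_wealth s e \<psi> t x j = x"
  by (cases j) auto

lemma wealth_fb_control: "wealth s e t x (fb_control s e \<psi> t x) j = fb_wealth s e \<psi> t x j"
  by (induction j) (auto simp: fb_control_def)

text \<open>Started at stage \<open>k\<close>, the wealth fed to \<open>\<psi> k\<close> is
  \<open>y\<close> itself, so freezing the control at its value there changes nothing. The control
  of \<open>\<psi>\<close> thus becomes one of the deviations \<open>u\<close>, and one cost formula
  covers both sides of the equilibrium inequality.\<close>

lemma fb_wealth_fun_upd_same:
  "fb_wealth s e (\<psi>(k := \<lambda>_. \<psi> k y)) k y j = fb_wealth s e \<psi> k y j"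
proof (induction j)
  case (Suc j)
  then show ?case by (cases "j = k") (auto simp: fb_wealth_initial)
qed simp

text \<open>After the deviation the path is a fresh start of the unmodified strategy at
  \<open>Suc k\<close>, so moment formulas valid from stage \<open>Suc k\<close> apply to
  it.\<close>

lemma fb_wealth_fun_upd:
  "Suc k \<le> j \<Longrightarrow> fb_wealth s e (\<psi>(k := \<lambda>_. u)) k y j
     = fb_wealth s e \<psi> (Suc k) (\<lambda>\<omega>. s k * y \<omega> + excess s e k \<omega> \<bullet> u \<omega>) j"
proof (induction j rule: dec_induct)
  case base
  show ?case by (simp add: fb_wealth_initial)
qed simp

lemma cost_fun_upd_same:
  "cost M s e \<mu>1 \<mu>2 N k y (fb_control s e (\<psi>(k := \<lambda>_. \<psi> k y)) k y)
     = cost M s e \<mu>1 \<mu>2 N k y (fb_control s e \<psi> k y)"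
  by (simp add: cost_def[abs_def] wealth_fb_control fb_wealth_fun_upd_same)

text \<open>Completing the square: the difference of the two sides is the form of \<open>A\<close>
  at \<open>u - f\<close>.\<close>

lemma quadratic_minimum:
  fixes A :: "real^'n^'n"
  assumes "psd A" "A *v f = - g"
  shows "f \<bullet> (A *v f) + 2 * (g \<bullet> f) \<le> u \<bullet> (A *v u) + 2 * (g \<bullet> u)"
proof -
  have sym: "transpose A = A" and "0 \<le> (u - f) \<bullet> (A *v (u - f))"
    using assms(1) by (auto simp: psd_def)
  moreover have "f \<bullet> (A *v u) = - (g \<bullet> u)" "u \<bullet> (A *v f) = - (g \<bullet> u)" "f \<bullet> (A *v f) = - (g \<bullet> f)"
    using symmetric_inner_mult[OF sym, of f u] assms(2) by (simp_all add: inner_commute)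
  ultimately show ?thesis
    by (simp add: matrix_vector_mult_diff_distrib inner_diff_left inner_diff_right)
qed

text \<open>Test \<open>f\<close> against the gradient step \<open>f - t (A f + g)\<close>.\<close>
lemma quadratic_minimizer_AE:
  fixes A :: "real^'n^'n" and f g :: "'a \<Rightarrow> real^'n"
  assumes A: "transpose A = A" and F: "subalgebra M F" and f: "f \<in> l2 M F" and g: "g \<in> l2 M F"
    and min: "\<And>u. u \<in> l2 M F \<Longrightarrow>
      AE \<omega> in M. f \<omega> \<bullet> (A *v f \<omega>) + 2 * (g \<omega> \<bullet> f \<omega>) \<le> u \<omega> \<bullet> (A *v u \<omega>) + 2 * (g \<omega> \<bullet> u \<omega>)"
  shows "AE \<omega> in M. A *v f \<omega> = - g \<omega>"
proof -
  obtain K where K: "0 < K" "\<And>x. norm (A *v x) \<le> norm x * K"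
    using bounded_linear.pos_bounded[OF matrix_vector_mul_bounded_linear[of A]] by blast
  define d where "d = (\<lambda>\<omega>. A *v f \<omega> + g \<omega>)"
  \<comment> \<open>\<open>K\<close> bounds the operator norm of \<open>A\<close>, so with this step
    the second-order increase is at most \<open>t * (d \<bullet> d)\<close>, half of the first-order
    decrease. As \<open>d\<close> is linear in \<open>f\<close> and \<open>g\<close>, the test
    control stays square-integrable.\<close>
  define t where "t = 1 / K"
  have t: "0 < t" "t * K = 1" using K by (auto simp: t_def)
  have d: "d \<in> l2 M F"
    unfolding d_def by (intro l2_add F g l2_bounded_linear[OF F _ f]) simp
  have "(\<lambda>\<omega>. f \<omega> + (- t) *\<^sub>R d \<omega>) \<in> l2 M F"
    by (intro l2_add F f l2_bounded_linear[OF F _ d] bounded_linear_scaleR_right)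
  from min[OF this] show ?thesis
  proof eventually_elim
    case (elim \<omega>)
    let ?f = "f \<omega>" and ?g = "g \<omega>" and ?d = "d \<omega>"
    have "?f \<bullet> (A *v ?d) = (A *v ?f) \<bullet> ?d"
      using symmetric_inner_mult[OF A, of ?f ?d] by simp
    with elim have "2 * t * ((A *v ?f) \<bullet> ?d + ?g \<bullet> ?d) \<le> t * (t * (?d \<bullet> (A *v ?d)))"
      by (simp add: matrix_vector_mult_diff_distrib matrix_vector_mult_scaleR
          inner_simps inner_commute[of ?d "A *v ?f"] algebra_simps)
    moreover have "(A *v ?f) \<bullet> ?d + ?g \<bullet> ?d = ?d \<bullet> ?d"
      by (simp add: d_def inner_add_left)
    ultimately have "2 * t * (?d \<bullet> ?d) \<le> t * (t * (?d \<bullet> (A *v ?d)))" by simp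
    then have "2 * (?d \<bullet> ?d) \<le> t * (?d \<bullet> (A *v ?d))"
      using t(1) by (simp add: mult.assoc mult.left_commute)
    also have "\<dots> \<le> t * (norm ?d * (norm ?d * K))"
      using t(1) norm_cauchy_schwarz[of ?d "A *v ?d"] mult_left_mono[OF K(2)[of ?d] norm_ge_zero[of ?d]]
      by (intro mult_left_mono) auto
    also have "\<dots> = (t * K) * (?d \<bullet> ?d)" by (simp add: dot_square_norm power2_eq_square)
    finally have "?d \<bullet> ?d \<le> 0" unfolding t(2) by simp
    then have "?d = 0" using inner_ge_zero[of ?d] by (metis antisym inner_eq_zero_iff)
    then show ?case by (simp add: d_def eq_neg_iff_add_eq_0)
  qed
qed

text \<open>If \<open>V = 0\<close>, then \<open>U \<noteq> 0\<close>, and \<open>m\<close> itself lies in the range of the matrix.\<close>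
lemma kernel_mean_cov:
  fixes C :: "real^'n^'n"
  defines "Q \<equiv> \<lambda>V S m. V *\<^sub>R outer m m + S *\<^sub>R C"
  assumes C: "psd C" and S: "0 < S" and V: "0 \<le> V" "V = 0 \<Longrightarrow> U \<noteq> 0"
    and a: "Q V S m *v a = (\<sigma> * V + U) *\<^sub>R m" and v: "Q V S m *v v = 0"
  shows "m \<bullet> v = 0" "C *v v = 0"
proof -
  have Cs: "transpose C = C" and Cv: "0 \<le> v \<bullet> (C *v v)" using C by (auto simp: psd_def)
  have Qs: "transpose (Q V S m) = Q V S m"
    by (simp add: Q_def transpose_add_matrix transpose_scaleR_matrix transpose_outer Cs)
  have "v \<bullet> (Q V S m *v v) = V * (m \<bullet> v)\<^sup>2 + S * (v \<bullet> (C *v v))"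
    by (simp add: Q_def matrix_vector_mult_add_rdistrib scaleR_matrix_vector_mult outer_mult
        inner_add_right inner_commute power2_eq_square)
  then have sum0: "V * (m \<bullet> v)\<^sup>2 + S * (v \<bullet> (C *v v)) = 0" using v by simp
  have nn: "0 \<le> V * (m \<bullet> v)\<^sup>2" "0 \<le> S * (v \<bullet> (C *v v))" using S V Cv by auto
  then have z: "V * (m \<bullet> v)\<^sup>2 = 0" "S * (v \<bullet> (C *v v)) = 0" using sum0 by linarith+
  show "C *v v = 0" using z(2) S by (intro psd_mult_eq_0[OF C]) simp
  show "m \<bullet> v = 0"
  proof (cases "V = 0")
    case True
    have "U * (m \<bullet> v) = (Q V S m *v a) \<bullet> v" unfolding a using True by simp
    also have "\<dots> = 0" unfolding symmetric_inner_mult[OF Qs] v by simp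
    finally show ?thesis using V(2)[OF True] by simp
  qed (use z(1) in simp)
qed

section \<open>Moments of the terminal wealth after a deviation\<close>

context market begin

text \<open>\<open>quad\<close>, \<open>lin\<close> and \<open>aff\<close> are \<open>\<O>\<close>,
  \<open>\<L>\<close> and \<open>\<theta>\<close> as functions of the coefficients at stage
  \<open>Suc k\<close>. The control \<open>- (y gain + offset)\<close> is the affine candidate for
  the optimum at wealth \<open>y\<close>.\<close>

abbreviation "quad k S V \<equiv> V *\<^sub>R outer (mean_ret k) (mean_ret k) + S *\<^sub>R cov_ret k"
abbreviation "lin k V U \<equiv> (s k * V + U) *\<^sub>R mean_ret k"
abbreviation "aff k p \<equiv> p *\<^sub>R mean_ret k"
abbreviation "gain k S V U \<equiv> pinv (quad k S V) *v lin k V U"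
abbreviation "offset k S V p \<equiv> pinv (quad k S V) *v aff k p"

lemma transpose_cov_ret: "k < N \<Longrightarrow> transpose (cov_ret k) = cov_ret k"
  using psd_cov_ret by (simp add: psd_def)

lemma transpose_quad: "k < N \<Longrightarrow> transpose (quad k S V) = quad k S V"
  by (simp add: transpose_add_matrix transpose_scaleR_matrix transpose_outer transpose_cov_ret)

lemma inner_quad: "u \<bullet> (quad k S V *v v)
    = V * (mean_ret k \<bullet> u) * (mean_ret k \<bullet> v) + S * (u \<bullet> (cov_ret k *v v))"
  by (simp add: matrix_vector_mult_add_rdistrib scaleR_matrix_vector_mult outer_mult
        inner_add_right inner_commute)

lemma psd_quad:
  assumes "k < N" "0 \<le> S" "0 \<le> V"
  shows "psd (quad k S V)"
  using transpose_quad[OF assms(1)] psd_cov_ret[OF assms(1)] assms(2,3)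
  unfolding psd_def inner_quad by (simp add: mult.assoc)

definition terminal_moments ::
    "(nat \<Rightarrow> ('a, 'm) strategy) \<Rightarrow> nat \<Rightarrow> real \<Rightarrow> real \<Rightarrow> real \<Rightarrow> real \<Rightarrow> real \<Rightarrow> bool" where
  "terminal_moments \<psi> k \<alpha> \<gamma> S q r \<longleftrightarrow> (\<forall>y\<in>l2 M (Fk k).
     cond_exp_is k (fb_wealth s e \<psi> k y N) (\<lambda>\<omega>. \<alpha> * y \<omega> + \<gamma>) \<and>
     cond_exp_is k (\<lambda>\<omega>. (fb_wealth s e \<psi> k y N \<omega>)\<^sup>2) (\<lambda>\<omega>. S * (y \<omega>)\<^sup>2 + 2 * q * y \<omega> + r))"

text \<open>By the tower property: the deviation leads to the next wealth, from which the terminal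
  moments at \<open>Suc k\<close> are known, and these are conditioned on \<open>Fk k\<close> by the
  one-step moments.\<close>

lemma
  assumes k: "k < N" and tm: "terminal_moments \<psi> (Suc k) \<alpha> \<gamma> S q r"
    and y: "y \<in> l2 M (Fk k)" and u: "u \<in> l2 M (Fk k)"
  defines "Z \<equiv> fb_wealth s e (\<psi>(k := \<lambda>_. u)) k y N"
  shows cond_exp_terminal: "cond_exp_is k Z (\<lambda>\<omega>. \<alpha> * (s k * y \<omega> + mean_ret k \<bullet> u \<omega>) + \<gamma>)"
    and cond_exp_terminal_sq: "cond_exp_is k (\<lambda>\<omega>. (Z \<omega>)\<^sup>2)
      (\<lambda>\<omega>. S * ((s k * y \<omega> + mean_ret k \<bullet> u \<omega>)\<^sup>2 + u \<omega> \<bullet> (cov_ret k *v u \<omega>))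
         + 2 * q * (s k * y \<omega> + mean_ret k \<bullet> u \<omega>) + r)"
proof -
  have k': "k \<le> N" "k \<le> Suc k" "Suc k \<le> N" using k by auto
  note X = next_wealth_in_l2[OF k y u] and X1 = cond_exp_next_wealth[OF k y u]
    and X2 = cond_exp_next_wealth_sq[OF k y u]
  have Z: "Z = fb_wealth s e \<psi> (Suc k) (\<lambda>\<omega>. s k * y \<omega> + ret k \<omega> \<bullet> u \<omega>) N"
    unfolding Z_def using k' by (intro fb_wealth_fun_upd) simp
  note tmX = tm[unfolded terminal_moments_def, rule_format, OF X, folded Z]
  show "cond_exp_is k Z (\<lambda>\<omega>. \<alpha> * (s k * y \<omega> + mean_ret k \<bullet> u \<omega>) + \<gamma>)"
    by (rule cond_exp_is_tower[OF k'(2,3) conjunct1[OF tmX]])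
       (intro cond_exp_is_add cond_exp_is_cmult cond_exp_is_const X1 k')
  show "cond_exp_is k (\<lambda>\<omega>. (Z \<omega>)\<^sup>2)
      (\<lambda>\<omega>. S * ((s k * y \<omega> + mean_ret k \<bullet> u \<omega>)\<^sup>2 + u \<omega> \<bullet> (cov_ret k *v u \<omega>))
         + 2 * q * (s k * y \<omega> + mean_ret k \<bullet> u \<omega>) + r)"
    by (rule cond_exp_is_tower[OF k'(2,3) conjunct2[OF tmX]])
       (intro cond_exp_is_add cond_exp_is_cmult cond_exp_is_const X1 X2 k')
qed

text \<open>Conditional variance as conditional second moment minus squared conditional mean. The
  version \<open>g\<close> of the mean is \<open>Fk k\<close>-measurable and square-integrable, so
  it can be pulled out of the cross term.\<close>

lemma cost_eq_moments:
  assumes k: "k \<le> N" and Z: "Z = wealth s e k y u N"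
    and Z1: "cond_exp_is k Z g" and Z2: "cond_exp_is k (\<lambda>\<omega>. (Z \<omega>)\<^sup>2) h" and g: "g \<in> l2 M (Fk k)"
  shows "AE \<omega> in M. cost M s e \<mu>1 \<mu>2 N k y u \<omega> = h \<omega> - (g \<omega>)\<^sup>2 - (\<mu>1 * y \<omega> + \<mu>2) * g \<omega>"
proof -
  interpret cond: sigma_finite_subalgebra M "Fk k" by (rule sigma_finite_subalg[OF k])
  let ?E = "real_cond_exp M (Fk k)"
  note sub = subalgebra_Fk[OF k]
  have MM: "subalgebra M M" by (simp add: subalgebra_def)
  have Zm[measurable]: "Z \<in> borel_measurable M" using Z1 by (auto simp: cond_exp_is_def)
  have gm[measurable]: "g \<in> borel_measurable M" by (rule l2_measurable_subalg[OF sub g])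
  have Zl: "Z \<in> l2 M M" using Z2 Zm by (simp add: l2_def cond_exp_is_def)
  have gZ: "integrable M (\<lambda>\<omega>. g \<omega> * Z \<omega>)"
    by (rule l2_mult_integrable[OF MM l2_mono[OF sub g] Zl])
  have gg: "integrable M (\<lambda>\<omega>. g \<omega> * g \<omega>)"
    by (rule l2_mult_integrable[OF sub g g])
  have "cond_exp_is k (\<lambda>\<omega>. (Z \<omega>)\<^sup>2 + ((- 2) * (g \<omega> * Z \<omega>) + g \<omega> * g \<omega>))
     (\<lambda>\<omega>. h \<omega> + ((- 2) * (g \<omega> * g \<omega>) + g \<omega> * g \<omega>))"
    using l2_measurable[OF g]
    by (intro cond_exp_is_add cond_exp_is_cmult cond_exp_is_mult cond_exp_is_self k Z1 Z2 gZ gg) auto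
  then have "AE \<omega> in M. ?E (\<lambda>\<omega>. (Z \<omega>)\<^sup>2 + ((- 2) * (g \<omega> * Z \<omega>) + g \<omega> * g \<omega>)) \<omega>
      = h \<omega> + ((- 2) * (g \<omega> * g \<omega>) + g \<omega> * g \<omega>)"
    by (simp add: cond_exp_is_def)
  moreover have "AE \<omega> in M. ?E (\<lambda>\<omega>. (Z \<omega> - ?E Z \<omega>)\<^sup>2) \<omega>
      = ?E (\<lambda>\<omega>. (Z \<omega>)\<^sup>2 + ((- 2) * (g \<omega> * Z \<omega>) + g \<omega> * g \<omega>)) \<omega>"
  proof (rule cond.real_cond_exp_cong)
    show "AE \<omega> in M. (Z \<omega> - ?E Z \<omega>)\<^sup>2 = (Z \<omega>)\<^sup>2 + ((- 2) * (g \<omega> * Z \<omega>) + g \<omega> * g \<omega>)"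
      using Z1 unfolding cond_exp_is_def by (auto simp: power2_eq_square algebra_simps)
  qed measurable
  moreover have "AE \<omega> in M. ?E Z \<omega> = g \<omega>" using Z1 by (simp add: cond_exp_is_def)
  ultimately show ?thesis
    unfolding cost_def Let_def Z[symmetric]
    by eventually_elim (simp add: power2_eq_square)
qed

end

section \<open>Backward propagation of the moment coefficients\<close>

locale mv_market = market M N s e
  for M :: "'a measure" and N :: nat and s :: "nat \<Rightarrow> real" and e :: "nat \<Rightarrow> 'a \<Rightarrow> real^'m" +
  fixes \<mu>1 \<mu>2 :: real
  assumes \<mu>1: "\<mu>1 > 0"
begin

text \<open>The strategies after stage \<open>k\<close> are summarised by the coefficients of the first two conditional
  moments of the terminal wealth: writing \<open>X\<^sub>N = A y + B\<close>, one has \<open>\<alpha> = E A\<close>, \<open>S = E A\<^sup>2\<close>,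
  \<open>V = Var A\<close>, \<open>q = E (A B)\<close>, \<open>U = - \<mu>1 \<alpha> / 2\<close> and \<open>p = Cov A B - \<mu>2 \<alpha> / 2\<close>.\<close>
definition affine_moments :: "(nat \<Rightarrow> ('a, 'm) strategy) \<Rightarrow> nat \<Rightarrow> real \<Rightarrow> real \<Rightarrow> real \<Rightarrow> real \<Rightarrow> bool" where
  "affine_moments \<psi> k S V U p \<longleftrightarrow> 0 \<le> S \<and> 0 \<le> V \<and>
     (\<exists>\<alpha> \<gamma> q r. V = S - \<alpha>\<^sup>2 \<and> U = - \<mu>1 / 2 * \<alpha> \<and> p = q - \<alpha> * \<gamma> - \<mu>2 / 2 * \<alpha> \<and>
        (S = 0 \<longrightarrow> q = 0) \<and> terminal_moments \<psi> k \<alpha> \<gamma> S q r)"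

lemma affine_moments_terminal: "affine_moments \<psi> N 1 0 (- \<mu>1 / 2) (- \<mu>2 / 2)"
proof -
  have "terminal_moments \<psi> N 1 0 1 0 0"
    unfolding terminal_moments_def
  proof (intro ballI conjI)
    fix y :: "'a \<Rightarrow> real" assume y: "y \<in> l2 M (Fk N)"
    have "integrable M y" "integrable M (\<lambda>\<omega>. (y \<omega>)\<^sup>2)"
      using l2_real_integrable[OF subalgebra_Fk y] l2_integrable[OF y] by auto
    then have "cond_exp_is N y y" "cond_exp_is N (\<lambda>\<omega>. (y \<omega>)\<^sup>2) (\<lambda>\<omega>. (y \<omega>)\<^sup>2)"
      using l2_measurable[OF y] by (auto intro!: cond_exp_is_self)
    then show "cond_exp_is N (fb_wealth s e \<psi> N y N) (\<lambda>\<omega>. 1 * y \<omega> + 0)"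
      "cond_exp_is N (\<lambda>\<omega>. (fb_wealth s e \<psi> N y N \<omega>)\<^sup>2) (\<lambda>\<omega>. 1 * (y \<omega>)\<^sup>2 + 2 * 0 * y \<omega> + 0)"
      by (simp_all add: fb_wealth_initial)
  qed
  then show ?thesis
    unfolding affine_moments_def by (intro conjI exI[of _ 1] exI[of _ 0]) auto
qed

text \<open>\<open>c\<close> is the cost of \<open>u = 0\<close>.\<close>
lemma cost_quadratic:
  assumes k: "k < N" and am: "affine_moments \<psi> (Suc k) S V U p" and y: "y \<in> l2 M (Fk k)"
  obtains c where "\<And>u :: 'a \<Rightarrow> real^'m. u \<in> l2 M (Fk k) \<Longrightarrow>
    AE \<omega> in M. cost M s e \<mu>1 \<mu>2 N k y (fb_control s e (\<psi>(k := \<lambda>_. u)) k y) \<omega>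
      = u \<omega> \<bullet> (quad k S V *v u \<omega>) + 2 * ((y \<omega> *\<^sub>R lin k V U + aff k p) \<bullet> u \<omega>) + c \<omega>"
proof -
  from am obtain \<alpha> \<gamma> q r where V: "V = S - \<alpha>\<^sup>2" and U: "U = - \<mu>1 / 2 * \<alpha>"
    and p: "p = q - \<alpha> * \<gamma> - \<mu>2 / 2 * \<alpha>" and tm: "terminal_moments \<psi> (Suc k) \<alpha> \<gamma> S q r"
    unfolding affine_moments_def by blast
  have k': "k \<le> N" using k by simp
  note sub = subalgebra_Fk[OF k']
  define c where "c = (\<lambda>\<omega>. S * (s k * y \<omega>)\<^sup>2 + 2 * q * (s k * y \<omega>) + r - (\<alpha> * (s k * y \<omega>) + \<gamma>)\<^sup>2
     - (\<mu>1 * y \<omega> + \<mu>2) * (\<alpha> * (s k * y \<omega>) + \<gamma>))"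
  show thesis
  proof (rule that[of c])
    fix u :: "'a \<Rightarrow> real^'m" assume u: "u \<in> l2 M (Fk k)"
    let ?g = "\<lambda>\<omega>. \<alpha> * (s k * y \<omega> + mean_ret k \<bullet> u \<omega>) + \<gamma>"
    have lin_l2: "(\<lambda>\<omega>. c * z \<omega>) \<in> l2 M (Fk k)" if "z \<in> l2 M (Fk k)" for c and z :: "'a \<Rightarrow> real"
      by (rule l2_bounded_linear[OF sub bounded_linear_mult_right that])
    have g: "?g \<in> l2 M (Fk k)"
      by (intro l2_add[OF sub] lin_l2 y l2_const l2_bounded_linear[OF sub bounded_linear_inner_right u])
    have "AE \<omega> in M. cost M s e \<mu>1 \<mu>2 N k y (fb_control s e (\<psi>(k := \<lambda>_. u)) k y) \<omega> =
      S * ((s k * y \<omega> + mean_ret k \<bullet> u \<omega>)\<^sup>2 + u \<omega> \<bullet> (cov_ret k *v u \<omega>))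
         + 2 * q * (s k * y \<omega> + mean_ret k \<bullet> u \<omega>) + r - (?g \<omega>)\<^sup>2 - (\<mu>1 * y \<omega> + \<mu>2) * ?g \<omega>"
      using cond_exp_terminal[OF k tm y u] cond_exp_terminal_sq[OF k tm y u]
      by (intro cost_eq_moments[OF k' _ _ _ g]) (simp_all add: wealth_fb_control[abs_def])
    then show "AE \<omega> in M. cost M s e \<mu>1 \<mu>2 N k y (fb_control s e (\<psi>(k := \<lambda>_. u)) k y) \<omega>
      = u \<omega> \<bullet> (quad k S V *v u \<omega>) + 2 * ((y \<omega> *\<^sub>R lin k V U + aff k p) \<bullet> u \<omega>) + c \<omega>"
    proof eventually_elim
      case (elim \<omega>)
      \<comment> \<open>Subtracting the squared mean replaces \<open>S\<close> by
        \<open>V = S - \<alpha>\<^sup>2\<close> in the mean direction. The terms linear in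
        \<open>u\<close> collect into \<open>s k * V + U\<close> in front of \<open>y\<close> and
        into \<open>p\<close> without \<open>y\<close>, which explains the forms of \<open>U\<close>
        and \<open>p\<close>.\<close>
      show ?case unfolding elim inner_quad
        by (simp add: c_def V U p inner_add_left power2_eq_square field_simps)
    qed
  qed
qed

text \<open>The control \<open>\<psi> k y\<close> need not be affine in \<open>y\<close>, but it
  differs from \<open>- (y a + b)\<close> by a kernel vector of \<open>quad\<close>. Such vectors
  change neither mean nor covariance when \<open>S > 0\<close>, so the moments are those of the
  affine control, for any preimages \<open>a\<close> and \<open>b\<close>.\<close>

lemma affine_moments_step:
  assumes k: "k < N" and am: "affine_moments \<psi> (Suc k) S V U p"
    and \<psi>: "\<And>y. y \<in> l2 M (Fk k) \<Longrightarrow> \<psi> k y \<in> l2 M (Fk k)"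
      "\<And>y. y \<in> l2 M (Fk k) \<Longrightarrow> AE \<omega> in M. quad k S V *v \<psi> k y \<omega> = - (y \<omega> *\<^sub>R lin k V U + aff k p)"
    and a: "quad k S V *v a = lin k V U" and b: "quad k S V *v b = aff k p"
  defines "m \<equiv> mean_ret k" and "C \<equiv> cov_ret k"
  shows "affine_moments \<psi> k (S * ((s k - m \<bullet> a)\<^sup>2 + a \<bullet> (C *v a)))
     (V * (s k - m \<bullet> a)\<^sup>2 + S * (a \<bullet> (C *v a))) ((s k - m \<bullet> a) * U)
     ((s k - m \<bullet> a) * p - V * (s k - m \<bullet> a) * (m \<bullet> b) + S * (a \<bullet> (C *v b)))"
proof -
  from am obtain \<alpha> \<gamma> q r where V: "V = S - \<alpha>\<^sup>2" and U: "U = - \<mu>1 / 2 * \<alpha>"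
    and p: "p = q - \<alpha> * \<gamma> - \<mu>2 / 2 * \<alpha>" and S0: "S = 0 \<Longrightarrow> q = 0"
    and tm: "terminal_moments \<psi> (Suc k) \<alpha> \<gamma> S q r" and SV: "0 \<le> S" "0 \<le> V"
    unfolding affine_moments_def by blast
  have C: "psd C" and Cs: "transpose C = C" and Cn: "\<And>v. 0 \<le> v \<bullet> (C *v v)"
    using psd_cov_ret[OF k] by (auto simp: psd_def C_def)
  \<comment> \<open>With terminal wealth \<open>A y + B\<close> after stage \<open>k\<close>, the
    affine control gives the new pair \<open>A (s - O \<bullet> a)\<close> and
    \<open>B - A (O \<bullet> b)\<close>. Here \<open>d\<close> is the mean of
    \<open>s - O \<bullet> a\<close>, \<open>q'\<close> the new mixed moment and \<open>r'\<close>
    the new second moment of the constant part.\<close>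
  define d where "d = s k - m \<bullet> a"
  define q' where "q' = S * (a \<bullet> (C *v b) - d * (m \<bullet> b)) + q * d"
  define r' where "r' = S * ((m \<bullet> b)\<^sup>2 + b \<bullet> (C *v b)) - 2 * q * (m \<bullet> b) + r"
  have opt: "\<alpha> * (m \<bullet> f) = - (\<alpha> * (m \<bullet> (x *\<^sub>R a + b)))"
      "S * ((s k * x + m \<bullet> f)\<^sup>2 + f \<bullet> (C *v f)) + 2 * q * (s k * x + m \<bullet> f)
       = S * ((s k * x - m \<bullet> (x *\<^sub>R a + b))\<^sup>2 + (x *\<^sub>R a + b) \<bullet> (C *v (x *\<^sub>R a + b)))
         + 2 * q * (s k * x - m \<bullet> (x *\<^sub>R a + b))"
    if f: "quad k S V *v f = - (x *\<^sub>R lin k V U + aff k p)" for f x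
  proof -
    let ?w = "x *\<^sub>R a + b"
    have "\<alpha> * (m \<bullet> f) = - (\<alpha> * (m \<bullet> ?w)) \<and>
      S * ((s k * x + m \<bullet> f)\<^sup>2 + f \<bullet> (C *v f)) + 2 * q * (s k * x + m \<bullet> f)
       = S * ((s k * x - m \<bullet> ?w)\<^sup>2 + ?w \<bullet> (C *v ?w)) + 2 * q * (s k * x - m \<bullet> ?w)"
    proof (cases "S = 0")
      \<comment> \<open>From \<open>0 \<le> V = S - \<alpha>\<^sup>2\<close> also
        \<open>\<alpha> = 0\<close>, and \<open>q = 0\<close> by the side condition in
        \<open>affine_moments\<close>, so every term vanishes.\<close>
      case True
      then show ?thesis using S0 V SV by simp
    next
      case False
      then have S: "0 < S" using SV by simp
      have v: "quad k S V *v (f + ?w) = 0"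
        using f a b by (simp add: matrix_vector_right_distrib matrix_vector_mult_scaleR)
      \<comment> \<open>Here \<open>\<alpha>\<^sup>2 = S > 0\<close>, and positivity of
        \<open>\<mu>1\<close> makes \<open>U\<close> nonzero.\<close>
      have U0: "U \<noteq> 0" if "V = 0"
        using that V U \<mu>1 S by auto
      have "m \<bullet> (f + ?w) = 0" and Cv: "C *v (f + ?w) = 0"
        unfolding m_def C_def
        using kernel_mean_cov[OF psd_cov_ret[OF k] S SV(2) U0 a v] by auto
      then have mf: "m \<bullet> f = - (m \<bullet> ?w)" by (simp add: inner_add_right)
      have Cf: "C *v f = - (C *v ?w)"
        using Cv unfolding matrix_vector_right_distrib[of C f] by (simp only: eq_neg_iff_add_eq_0)
      have "f \<bullet> (C *v f) = - (f \<bullet> (C *v ?w))" using Cf by simp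
      also have "f \<bullet> (C *v ?w) = (C *v f) \<bullet> ?w" using symmetric_inner_mult[OF Cs] by simp
      also have "\<dots> = - (?w \<bullet> (C *v ?w))" unfolding Cf by (simp add: inner_commute)
      finally show ?thesis using mf by simp
    qed
    then show "\<alpha> * (m \<bullet> f) = - (\<alpha> * (m \<bullet> ?w))"
      "S * ((s k * x + m \<bullet> f)\<^sup>2 + f \<bullet> (C *v f)) + 2 * q * (s k * x + m \<bullet> f)
       = S * ((s k * x - m \<bullet> ?w)\<^sup>2 + ?w \<bullet> (C *v ?w)) + 2 * q * (s k * x - m \<bullet> ?w)"
      by blast+
  qed
  have bCa: "b \<bullet> (C *v a) = a \<bullet> (C *v b)"
    using symmetric_inner_mult[OF Cs, of b a] by (simp add: inner_commute)
  have "terminal_moments \<psi> k (\<alpha> * d) (\<gamma> - \<alpha> * (m \<bullet> b)) (S * (d\<^sup>2 + a \<bullet> (C *v a))) q' r'"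
    unfolding terminal_moments_def
  proof (intro ballI conjI)
    fix y :: "'a \<Rightarrow> real" assume y: "y \<in> l2 M (Fk k)"
    note Z = cond_exp_terminal[OF k tm y \<psi>(1)[OF y]] cond_exp_terminal_sq[OF k tm y \<psi>(1)[OF y]]
    show "cond_exp_is k (fb_wealth s e \<psi> k y N) (\<lambda>\<omega>. \<alpha> * d * y \<omega> + (\<gamma> - \<alpha> * (m \<bullet> b)))"
    proof (rule cond_exp_is_AE_eq[OF Z(1)[unfolded fb_wealth_fun_upd_same]])
      show "AE \<omega> in M. \<alpha> * (s k * y \<omega> + mean_ret k \<bullet> \<psi> k y \<omega>) + \<gamma> = \<alpha> * d * y \<omega> + (\<gamma> - \<alpha> * (m \<bullet> b))"
        using \<psi>(2)[OF y]
      proof eventually_elim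
        case (elim \<omega>)
        show ?case using opt(1)[OF elim]
          by (simp add: m_def[symmetric] d_def inner_add_right algebra_simps)
      qed
    qed
    show "cond_exp_is k (\<lambda>\<omega>. (fb_wealth s e \<psi> k y N \<omega>)\<^sup>2)
        (\<lambda>\<omega>. S * (d\<^sup>2 + a \<bullet> (C *v a)) * (y \<omega>)\<^sup>2 + 2 * q' * y \<omega> + r')"
    proof (rule cond_exp_is_AE_eq[OF Z(2)[unfolded fb_wealth_fun_upd_same]])
      show "AE \<omega> in M. S * ((s k * y \<omega> + mean_ret k \<bullet> \<psi> k y \<omega>)\<^sup>2 + \<psi> k y \<omega> \<bullet> (cov_ret k *v \<psi> k y \<omega>))
           + 2 * q * (s k * y \<omega> + mean_ret k \<bullet> \<psi> k y \<omega>) + r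
         = S * (d\<^sup>2 + a \<bullet> (C *v a)) * (y \<omega>)\<^sup>2 + 2 * q' * y \<omega> + r'"
        using \<psi>(2)[OF y]
      proof eventually_elim
        case (elim \<omega>)
        show ?case unfolding opt(2)[OF elim, unfolded m_def C_def]
          unfolding m_def[symmetric] C_def[symmetric]
          by (simp add: d_def q'_def r'_def inner_add_right inner_add_left matrix_vector_right_distrib
              matrix_vector_mult_scaleR bCa power2_eq_square algebra_simps)
      qed
    qed
  qed
  \<comment> \<open>The side condition is inherited: if the new \<open>S\<close> vanishes while the
    old one does not, then \<open>d = 0\<close> and \<open>C *v a = 0\<close>, which removes every
    term of \<open>q'\<close>.\<close>
  moreover have "q' = 0" if "S * (d\<^sup>2 + a \<bullet> (C *v a)) = 0"
  proof (cases "S = 0")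
    case False
    then have "d\<^sup>2 + a \<bullet> (C *v a) = 0" using that by simp
    then have "d\<^sup>2 = 0" "a \<bullet> (C *v a) = 0"
      using Cn[of a] zero_le_power2[of d] by linarith+
    then have "d = 0" "C *v a = 0" using psd_mult_eq_0[OF C] by auto
    then show ?thesis using bCa by (simp add: q'_def)
  qed (use S0 in \<open>simp add: q'_def\<close>)
  moreover have "V * d\<^sup>2 + S * (a \<bullet> (C *v a)) = S * (d\<^sup>2 + a \<bullet> (C *v a)) - (\<alpha> * d)\<^sup>2"
    unfolding V by (simp add: power2_eq_square algebra_simps)
  moreover have "d * p - V * d * (m \<bullet> b) + S * (a \<bullet> (C *v b))
      = q' - (\<alpha> * d) * (\<gamma> - \<alpha> * (m \<bullet> b)) - \<mu>2 / 2 * (\<alpha> * d)"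
    unfolding V p q'_def by (simp add: power2_eq_square algebra_simps)
  moreover have "d * U = - \<mu>1 / 2 * (\<alpha> * d)" unfolding U by simp
  moreover have "0 \<le> S * (d\<^sup>2 + a \<bullet> (C *v a))" "0 \<le> V * d\<^sup>2 + S * (a \<bullet> (C *v a))"
    using SV Cn[of a] by auto
  ultimately show ?thesis
    unfolding affine_moments_def d_def[symmetric] by blast
qed

end

section \<open>Equilibria and the difference equations\<close>

text \<open>Ordinary recursion in reversed time: \<open>Y j\<close> is the value at stage
  \<open>N - j\<close>.\<close>

lemma backward_recursion:
  fixes f :: "nat \<Rightarrow> 'b \<Rightarrow> 'b"
  obtains X where "X N = z" "\<And>k. k < N \<Longrightarrow> X k = f k (X (Suc k))"
proof -
  define Y where "Y = rec_nat z (\<lambda>j. f (N - Suc j))"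
  show thesis
  proof (rule that[of "\<lambda>k. Y (N - k)"])
    show "Y (N - N) = z" by (simp add: Y_def)
    fix k assume "k < N"
    then have "N - k = Suc (N - Suc k)" "N - Suc (N - Suc k) = k" by auto
    then show "Y (N - k) = f k (Y (N - Suc k))" by (simp add: Y_def)
  qed
qed

context mv_market begin

text \<open>One backward step for all four coefficients, kept in the literal form of the difference
  equations so that the equivalence with them is mere repackaging. The argument tuple belongs to
  stage \<open>Suc k\<close>.\<close>

definition riccati :: "nat \<Rightarrow> real \<times> real \<times> real \<times> real \<Rightarrow> real \<times> real \<times> real \<times> real" where
  "riccati k = (\<lambda>(S, V, U, p).
     let m = mean_ret k; a = gain k S V U
     in (S * ((s k)\<^sup>2 - 2 * s k * (m \<bullet> a) + lin k V U \<bullet> (pinv (quad k S V) *v (second_moment M (ret k) *v a))),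
       (s k)\<^sup>2 * V - 2 * s k * V * (m \<bullet> a) + lin k V U \<bullet> a,
       (s k - m \<bullet> a) * U,
       - (((s k * V) *\<^sub>R m - (lin k V U v* pinv (quad k S V)) v* quad k S V) \<bullet> offset k S V p)
         + (s k - m \<bullet> a) * p))"

definition solvable_at :: "nat \<Rightarrow> real \<times> real \<times> real \<times> real \<Rightarrow> bool" where
  "solvable_at k = (\<lambda>(S, V, U, p). psd (quad k S V) \<and>
     quad k S V *v gain k S V U = lin k V U \<and> quad k S V *v offset k S V p = aff k p)"

lemma difference_equations_solvable_iff:
  "difference_equations_solvable M s e \<mu>1 \<mu>2 N \<longleftrightarrow>
     (\<exists>X. X N = (1, 0, - \<mu>1 / 2, - \<mu>2 / 2) \<and>
       (\<forall>k<N. X k = riccati k (X (Suc k)) \<and> solvable_at k (X (Suc k))))" (is "_ \<longleftrightarrow> (\<exists>X. ?P X)")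
proof -
  have "difference_equations_solvable M s e \<mu>1 \<mu>2 N \<longleftrightarrow> (\<exists>S V U p. ?P (\<lambda>k. (S k, V k, U k, p k)))"
    unfolding difference_equations_solvable_def riccati_def solvable_at_def Let_def
    by (simp only: split_conv prod.inject conj_assoc)
  also have "\<dots> \<longleftrightarrow> (\<exists>X. ?P X)"
  proof (intro iffI; elim exE)
    fix X assume X: "?P X"
    define S V U p where "S k = fst (X k)" and "V k = fst (snd (X k))"
      and "U k = fst (snd (snd (X k)))" and "p k = snd (snd (snd (X k)))" for k
    have "X = (\<lambda>k. (S k, V k, U k, p k))" by (simp add: S_def V_def U_def p_def)
    from X[unfolded this] show "\<exists>S V U p. ?P (\<lambda>k. (S k, V k, U k, p k))"
      by (intro exI)
  next
    fix S V U p assume "?P (\<lambda>k. (S k, V k, U k, p k))"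
    then show "\<exists>X. ?P X" by (rule exI[where P = ?P])
  qed
  finally show ?thesis .
qed

text \<open>The range condition gives \<open>\<L> = \<O> a\<close>, and \<open>\<O>\<close> and its
  pseudoinverse are symmetric. Inner products with \<open>\<L>\<close> thus become mean and
  covariance terms in \<open>a\<close>, which yields the coefficients of
  \<open>affine_moments_step\<close>.\<close>

lemma riccati_eq:
  assumes k: "k < N" and sol: "solvable_at k (S, V, U, p)"
  defines "m \<equiv> mean_ret k" and "C \<equiv> cov_ret k" and "a \<equiv> gain k S V U" and "b \<equiv> offset k S V p"
  shows "riccati k (S, V, U, p) =
    (S * ((s k - m \<bullet> a)\<^sup>2 + a \<bullet> (C *v a)), V * (s k - m \<bullet> a)\<^sup>2 + S * (a \<bullet> (C *v a)),
     (s k - m \<bullet> a) * U, (s k - m \<bullet> a) * p - V * (s k - m \<bullet> a) * (m \<bullet> b) + S * (a \<bullet> (C *v b)))"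
proof -
  let ?Q = "quad k S V"
  have a: "?Q *v a = lin k V U" using sol by (simp add: solvable_at_def a_def)
  note Qs = transpose_quad[OF k] and Ps = transpose_pinv[OF transpose_quad[OF k]]
  have "lin k V U \<bullet> (pinv ?Q *v (second_moment M (ret k) *v a)) = a \<bullet> (second_moment M (ret k) *v a)"
    unfolding a_def using symmetric_inner_mult[OF Ps] by simp
  also have "\<dots> = a \<bullet> (C *v a) + (m \<bullet> a)\<^sup>2"
    by (simp add: second_moment_ret[OF k] m_def C_def matrix_vector_mult_add_rdistrib outer_mult
        inner_add_right inner_commute power2_eq_square)
  finally have 1: "lin k V U \<bullet> (pinv ?Q *v (second_moment M (ret k) *v a)) = a \<bullet> (C *v a) + (m \<bullet> a)\<^sup>2" .
  have la: "lin k V U \<bullet> v = V * (m \<bullet> a) * (m \<bullet> v) + S * (a \<bullet> (C *v v))" for v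
    unfolding a[symmetric] symmetric_inner_mult[OF Qs] inner_quad m_def C_def ..
  \<comment> \<open>The bracket in \<open>\<beta>\<close> is \<open>\<O>\<close> itself, so its
    second summand collapses to \<open>\<L>\<close>.\<close>
  have "(lin k V U v* pinv ?Q) v* ?Q = lin k V U"
    using a by (simp only: symmetric_vector_mult[OF Qs] symmetric_vector_mult[OF Ps] a_def)
  then have 2: "((s k * V) *\<^sub>R mean_ret k - (lin k V U v* pinv ?Q) v* ?Q) \<bullet> b
      = s k * V * (m \<bullet> b) - lin k V U \<bullet> b"
    by (simp only: inner_diff_left inner_scaleR_left m_def)
  show ?thesis
    unfolding riccati_def Let_def split_conv prod.inject
    unfolding a_def[symmetric] b_def[symmetric]
    unfolding 1 2
    unfolding la
    unfolding m_def[symmetric]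
    by (simp add: power2_eq_square algebra_simps)
qed

abbreviation affine_moments_at :: "(nat \<Rightarrow> ('a, 'm) strategy) \<Rightarrow> nat \<Rightarrow> real \<times> real \<times> real \<times> real \<Rightarrow> bool" where
  "affine_moments_at \<psi> k \<equiv> (\<lambda>(S, V, U, p). affine_moments \<psi> k S V U p)"

text \<open>The first-order condition for the cost at stage \<open>k\<close>, required from every
  wealth \<open>y\<close>; the tuple holds the coefficients at stage \<open>Suc k\<close>.\<close>

definition stationary :: "(nat \<Rightarrow> ('a, 'm) strategy) \<Rightarrow> nat \<Rightarrow> real \<times> real \<times> real \<times> real \<Rightarrow> bool" where
  "stationary \<psi> k = (\<lambda>(S, V, U, p). \<forall>y\<in>l2 M (Fk k). \<psi> k y \<in> l2 M (Fk k) \<and>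
     (AE \<omega> in M. quad k S V *v \<psi> k y \<omega> = - (y \<omega> *\<^sub>R lin k V U + aff k p)))"

lemma affine_moments_riccati:
  assumes k: "k < N" and am: "affine_moments_at \<psi> (Suc k) X"
    and st: "stationary \<psi> k X" and sol: "solvable_at k X"
  shows "affine_moments_at \<psi> k (riccati k X)"
proof -
  obtain S V U p where X: "X = (S, V, U, p)" by (cases X)
  show ?thesis
    using affine_moments_step[OF k, of \<psi> S V U p "gain k S V U" "offset k S V p"] am st sol
    unfolding X riccati_eq[OF k sol[unfolded X]] by (auto simp: stationary_def solvable_at_def)
qed

section \<open>Optimality, stationarity and solvability at one stage\<close>

lemma optimal_of_stationary:
  assumes k: "k < N" and am: "affine_moments_at \<psi> (Suc k) X" and st: "stationary \<psi> k X"
    and y: "y \<in> l2 M (Fk k)" and u: "u \<in> l2 M (Fk k)"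
  shows "AE \<omega> in M. cost M s e \<mu>1 \<mu>2 N k y (fb_control s e \<psi> k y) \<omega>
    \<le> cost M s e \<mu>1 \<mu>2 N k y (fb_control s e (\<psi>(k := \<lambda>_. u)) k y) \<omega>"
proof -
  obtain S V U p where X: "X = (S, V, U, p)" by (cases X)
  have am': "affine_moments \<psi> (Suc k) S V U p" using am X by simp
  then have psd: "psd (quad k S V)"
    by (intro psd_quad k) (auto simp: affine_moments_def)
  obtain c where c: "\<And>u :: 'a \<Rightarrow> real^'m. u \<in> l2 M (Fk k) \<Longrightarrow>
    AE \<omega> in M. cost M s e \<mu>1 \<mu>2 N k y (fb_control s e (\<psi>(k := \<lambda>_. u)) k y) \<omega>
      = u \<omega> \<bullet> (quad k S V *v u \<omega>) + 2 * ((y \<omega> *\<^sub>R lin k V U + aff k p) \<bullet> u \<omega>) + c \<omega>"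
    using cost_quadratic[OF k am' y] by blast
  have f: "\<psi> k y \<in> l2 M (Fk k)"
    and foc: "AE \<omega> in M. quad k S V *v \<psi> k y \<omega> = - (y \<omega> *\<^sub>R lin k V U + aff k p)"
    using st y unfolding stationary_def X by auto
  from c[OF f, unfolded cost_fun_upd_same] c[OF u] foc show ?thesis
  proof eventually_elim
    case (elim \<omega>)
    show ?case unfolding elim(1,2) using quadratic_minimum[OF psd elim(3)] by simp
  qed
qed

text \<open>The term \<open>c\<close> of the cost is common to all controls and cancels, leaving a
  quadratic minimised pointwise almost everywhere by \<open>\<psi> k y\<close> among
  square-integrable controls.\<close>

lemma stationary_of_optimal:
  assumes k: "k < N" and am: "affine_moments_at \<psi> (Suc k) X"
    and adm: "\<And>y. y \<in> l2 M (Fk k) \<Longrightarrow> \<psi> k y \<in> l2 M (Fk k)"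
    and opt: "\<And>y u. y \<in> l2 M (Fk k) \<Longrightarrow> u \<in> l2 M (Fk k) \<Longrightarrow>
      AE \<omega> in M. cost M s e \<mu>1 \<mu>2 N k y (fb_control s e \<psi> k y) \<omega>
        \<le> cost M s e \<mu>1 \<mu>2 N k y (fb_control s e (\<psi>(k := \<lambda>_. u)) k y) \<omega>"
  shows "stationary \<psi> k X"
proof -
  obtain S V U p where X: "X = (S, V, U, p)" by (cases X)
  have am': "affine_moments \<psi> (Suc k) S V U p" using am X by simp
  have k': "k \<le> N" using k by simp
  note sub = subalgebra_Fk[OF k']
  have "AE \<omega> in M. quad k S V *v \<psi> k y \<omega> = - (y \<omega> *\<^sub>R lin k V U + aff k p)"
    if y: "y \<in> l2 M (Fk k)" for y
  proof (rule quadratic_minimizer_AE[OF transpose_quad[OF k] sub adm[OF y]])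
    show "(\<lambda>\<omega>. y \<omega> *\<^sub>R lin k V U + aff k p) \<in> l2 M (Fk k)"
      by (intro l2_add[OF sub] l2_const l2_bounded_linear[OF sub bounded_linear_scaleR_left y])
    obtain c where c: "\<And>u :: 'a \<Rightarrow> real^'m. u \<in> l2 M (Fk k) \<Longrightarrow>
      AE \<omega> in M. cost M s e \<mu>1 \<mu>2 N k y (fb_control s e (\<psi>(k := \<lambda>_. u)) k y) \<omega>
        = u \<omega> \<bullet> (quad k S V *v u \<omega>) + 2 * ((y \<omega> *\<^sub>R lin k V U + aff k p) \<bullet> u \<omega>) + c \<omega>"
      using cost_quadratic[OF k am' y] by blast
    fix u :: "'a \<Rightarrow> real^'m" assume u: "u \<in> l2 M (Fk k)"
    from c[OF adm[OF y], unfolded cost_fun_upd_same] c[OF u] opt[OF y u]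
    show "AE \<omega> in M. \<psi> k y \<omega> \<bullet> (quad k S V *v \<psi> k y \<omega>) + 2 * ((y \<omega> *\<^sub>R lin k V U + aff k p) \<bullet> \<psi> k y \<omega>)
      \<le> u \<omega> \<bullet> (quad k S V *v u \<omega>) + 2 * ((y \<omega> *\<^sub>R lin k V U + aff k p) \<bullet> u \<omega>)"
      by eventually_elim linarith
  qed
  then show ?thesis using adm by (simp add: stationary_def X)
qed

text \<open>Constant wealths suffice: \<open>y = 0\<close> puts \<open>\<theta>\<close> into the
  range of \<open>\<O>\<close>, and subtracting this from \<open>y = 1\<close> puts
  \<open>\<L>\<close> there.\<close>

lemma solvable_at_of_stationary:
  assumes k: "k < N" and am: "affine_moments_at \<psi> (Suc k) X" and st: "stationary \<psi> k X"
  shows "solvable_at k X"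
proof -
  obtain S V U p where X: "X = (S, V, U, p)" by (cases X)
  have psd: "psd (quad k S V)"
    using am X by (intro psd_quad k) (auto simp: affine_moments_def)
  note Qs = transpose_quad[OF k]
  have range: "\<exists>v. quad k S V *v v = - (y *\<^sub>R lin k V U + aff k p)" for y
  proof -
    have "AE \<omega> in M. quad k S V *v \<psi> k (\<lambda>_. y) \<omega> = - (y *\<^sub>R lin k V U + aff k p)"
      using st l2_const[of y "Fk k"] by (auto simp: stationary_def X)
    \<comment> \<open>The existential no longer depends on \<open>\<omega>\<close>, so on a
      probability space it holds outright.\<close>
    then have "AE \<omega> in M. \<exists>v. quad k S V *v v = - (y *\<^sub>R lin k V U + aff k p)"
      by eventually_elim blast
    then show ?thesis by simp
  qed
  obtain v where v: "quad k S V *v v = - aff k p" using range[of 0] by auto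
  obtain w where w: "quad k S V *v w = - (lin k V U + aff k p)" using range[of 1] by auto
  have v': "quad k S V *v (- v) = aff k p"
    using v matrix_vector_mult_scaleR[of "quad k S V" "- 1" v] by simp
  have w': "quad k S V *v (v - w) = lin k V U"
    using v w by (simp only: matrix_vector_mult_diff_distrib) simp
  show ?thesis
    using psd mult_pinv_mult_of_range[OF Qs v'] mult_pinv_mult_of_range[OF Qs w']
    by (simp add: solvable_at_def X)
qed

text \<open>The recursions always generate some sequence \<open>X\<close>. Going backwards, the
  moments at \<open>Suc k\<close> give stationarity at \<open>k\<close>, hence the range conditions
  there, hence the moments at \<open>k\<close>.\<close>

lemma solvable_of_equilibrium:
  assumes adm: "admissible M e N 0 \<psi>" and ind: "state_independent M s e \<mu>1 \<mu>2 N 0 \<psi>"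
  shows "difference_equations_solvable M s e \<mu>1 \<mu>2 N"
proof -
  obtain X where XN: "X N = (1, 0, - \<mu>1 / 2, - \<mu>2 / 2)"
    and X: "\<And>k. k < N \<Longrightarrow> X k = riccati k (X (Suc k))"
    using backward_recursion[of N "(1, 0, - \<mu>1 / 2, - \<mu>2 / 2)" riccati] by blast
  have st: "stationary \<psi> k (X (Suc k))" if k: "k < N" and am: "affine_moments_at \<psi> (Suc k) (X (Suc k))" for k
  proof (rule stationary_of_optimal[OF k am])
    show "\<psi> k y \<in> l2 M (Fk k)" if "y \<in> l2 M (Fk k)" for y
      using adm k that by (simp add: admissible_def)
    show "AE \<omega> in M. cost M s e \<mu>1 \<mu>2 N k y (fb_control s e \<psi> k y) \<omega>
        \<le> cost M s e \<mu>1 \<mu>2 N k y (fb_control s e (\<psi>(k := \<lambda>_. u)) k y) \<omega>"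
      if y: "y \<in> l2 M (Fk k)" and u: "u \<in> l2 M (Fk k)" for y and u :: "'a \<Rightarrow> real^'m"
    proof -
      \<comment> \<open>Starting the path at stage \<open>k\<close> itself makes an arbitrary
        \<open>y\<close> the current wealth; this is what state independence supplies.\<close>
      have "equilibrium_along M s e \<mu>1 \<mu>2 N k y \<psi>"
        using ind k y by (simp add: state_independent_def)
      from this[unfolded equilibrium_along_def Let_def, rule_format, of k u] show ?thesis
        using k u by (simp add: fb_wealth_initial)
    qed
  qed
  have am: "affine_moments_at \<psi> k (X k)" if "k \<le> N" for k
    using that
  proof (induction rule: inc_induct)
    case base
    show ?case using affine_moments_terminal by (simp add: XN)
  next
    case (step k)
    note st = st[OF step.hyps(2) step.IH]
    show ?case
      unfolding X[OF step.hyps(2)]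
      by (rule affine_moments_riccati[OF step.hyps(2) step.IH st
          solvable_at_of_stationary[OF step.hyps(2) step.IH st]])
  qed
  then have "solvable_at k (X (Suc k))" if k: "k < N" for k
    using solvable_at_of_stationary[OF k _ st[OF k]] k by simp
  then show ?thesis
    unfolding difference_equations_solvable_iff using XN X by blast
qed

text \<open>The affine feedback \<open>- (y gain + offset)\<close> is stationary by the range
  conditions. As it is built without reference to \<open>t\<close> or \<open>x\<close>, a single
  strategy works for all initial pairs.\<close>

lemma equilibrium_of_solvable:
  assumes "difference_equations_solvable M s e \<mu>1 \<mu>2 N"
  obtains \<psi> where "\<And>t. admissible M e N t \<psi>" "\<And>t. state_independent M s e \<mu>1 \<mu>2 N t \<psi>"
    "\<And>t x. x \<in> l2 M (Fk t) \<Longrightarrow> equilibrium_along M s e \<mu>1 \<mu>2 N t x \<psi>"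
proof -
  obtain X where XN: "X N = (1, 0, - \<mu>1 / 2, - \<mu>2 / 2)"
    and X: "\<And>k. k < N \<Longrightarrow> X k = riccati k (X (Suc k))"
    and sol: "\<And>k. k < N \<Longrightarrow> solvable_at k (X (Suc k))"
    using assms unfolding difference_equations_solvable_iff by blast
  define \<psi> :: "nat \<Rightarrow> ('a, 'm) strategy" where
    "\<psi> k y = (case X (Suc k) of (S, V, U, p) \<Rightarrow> \<lambda>\<omega>. y \<omega> *\<^sub>R (- gain k S V U) + - offset k S V p)" for k y
  have st: "stationary \<psi> k (X (Suc k))" if k: "k < N" for k
  proof -
    obtain S V U p where X': "X (Suc k) = (S, V, U, p)" by (cases "X (Suc k)")
    have "\<psi> k y \<in> l2 M (Fk k)" if "y \<in> l2 M (Fk k)" for y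
      unfolding \<psi>_def X' prod.case
      using k by (intro l2_add l2_const l2_bounded_linear[OF _ bounded_linear_scaleR_left that] subalgebra_Fk) auto
    moreover have "quad k S V *v \<psi> k y \<omega> = - (y \<omega> *\<^sub>R lin k V U + aff k p)" for y \<omega>
    proof -
      have "\<psi> k y \<omega> = (- 1) *\<^sub>R (y \<omega> *\<^sub>R gain k S V U + offset k S V p)"
        by (simp add: \<psi>_def X')
      moreover have "quad k S V *v gain k S V U = lin k V U" "quad k S V *v offset k S V p = aff k p"
        using sol[OF k] by (auto simp: solvable_at_def X')
      ultimately show ?thesis
        by (simp only: matrix_vector_mult_scaleR matrix_vector_right_distrib) simp
    qed
    ultimately show ?thesis by (simp add: stationary_def X')
  qed
  have am: "affine_moments_at \<psi> k (X k)" if "k \<le> N" for k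
    using that
  proof (induction rule: inc_induct)
    case base
    show ?case using affine_moments_terminal by (simp add: XN)
  next
    case (step k)
    then show ?case
      unfolding X[OF step.hyps(2)] by (intro affine_moments_riccati st sol)
  qed
  have psi_l2: "\<psi> k y \<in> l2 M (Fk k)" if "k < N" "y \<in> l2 M (Fk k)" for k y
    using st[OF that(1)] that(2) by (auto simp: stationary_def split: prod.splits)
  \<comment> \<open>The path must stay square-integrable, since stagewise optimality is available
    only from such wealths.\<close>
  have wealth_l2: "fb_wealth s e \<psi> t x k \<in> l2 M (Fk k)"
    if "t \<le> k" "k \<le> N" and x: "x \<in> l2 M (Fk t)" for t x k
    using that(1,2)
  proof (induction k rule: dec_induct)
    case base
    show ?case using x by (simp add: fb_wealth_initial)
  next
    case (step k)
    then show ?case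
      using next_wealth_in_l2[OF _ step.IH psi_l2[OF _ step.IH]] by simp
  qed
  have eq: "equilibrium_along M s e \<mu>1 \<mu>2 N t x \<psi>" if x: "x \<in> l2 M (Fk t)" for t x
    unfolding equilibrium_along_def Let_def
  proof (intro ballI)
    fix k and u :: "'a \<Rightarrow> real^'m" assume k: "k \<in> {t..<N}" and u: "u \<in> l2 M (Fk k)"
    show "AE \<omega> in M. cost M s e \<mu>1 \<mu>2 N k (fb_wealth s e \<psi> t x k) (fb_control s e \<psi> k (fb_wealth s e \<psi> t x k)) \<omega>
       \<le> cost M s e \<mu>1 \<mu>2 N k (fb_wealth s e \<psi> t x k) (fb_control s e (\<psi>(k := \<lambda>_. u)) k (fb_wealth s e \<psi> t x k)) \<omega>"
      using k x u by (intro optimal_of_stationary[OF _ am st] wealth_l2) auto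
  qed
  show thesis
    using that[of \<psi>] psi_l2 eq by (auto simp: admissible_def state_independent_def)
qed

end

theorem theorem3p3:
  fixes M :: "'a measure" and N :: nat
    and s :: "nat \<Rightarrow> real" and e :: "nat \<Rightarrow> 'a \<Rightarrow> real^'m"
    and \<mu>1 \<mu>2 :: real
  assumes "prob_space M"
    and "N \<ge> 1"
    and "\<And>k. k < N \<Longrightarrow> s k > 1"
    and "prob_space.indep_vars M (\<lambda>_. borel) e {..<N}"
    and "\<And>k. k < N \<Longrightarrow> integrable M (\<lambda>\<omega>. (norm (e k \<omega>))\<^sup>2)"
    and "\<mu>1 > 0" and "\<mu>2 > 0"
  shows "(\<forall>t<N. \<forall>x\<in>l2 M (filt M e t). \<exists>\<psi>. feedback_equilibrium M s e \<mu>1 \<mu>2 N t x \<psi>)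
     \<longleftrightarrow> difference_equations_solvable M s e \<mu>1 \<mu>2 N"
proof -
  interpret prob_space M by fact
  interpret mv_market M N s e \<mu>1 \<mu>2
    using assms by unfold_locales auto
  show ?thesis
  proof
    assume "\<forall>t<N. \<forall>x\<in>l2 M (filt M e t). \<exists>\<psi>. feedback_equilibrium M s e \<mu>1 \<mu>2 N t x \<psi>"
    \<comment> \<open>One initial pair is enough: state independence from stage 0 covers every later
      stage and state.\<close>
    then obtain \<psi> where "feedback_equilibrium M s e \<mu>1 \<mu>2 N 0 (\<lambda>_. 0) \<psi>"
      using assms(2) l2_const[of 0] by fastforce
    then show "difference_equations_solvable M s e \<mu>1 \<mu>2 N"
      using solvable_of_equilibrium by (auto simp: feedback_equilibrium_def)
  next
    assume "difference_equations_solvable M s e \<mu>1 \<mu>2 N"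
    then obtain \<psi> where "\<And>t. admissible M e N t \<psi>" "\<And>t. state_independent M s e \<mu>1 \<mu>2 N t \<psi>"
      "\<And>t x. x \<in> l2 M (Fk t) \<Longrightarrow> equilibrium_along M s e \<mu>1 \<mu>2 N t x \<psi>"
      using equilibrium_of_solvable by blast
    then show "\<forall>t<N. \<forall>x\<in>l2 M (filt M e t). \<exists>\<psi>. feedback_equilibrium M s e \<mu>1 \<mu>2 N t x \<psi>"
      unfolding feedback_equilibrium_def by blast
  qed
qed

end
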